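(* Let $E\to M$ be a real vector bundle of rank $2n$ over a smooth manifold, equipped with a connection $\nabla$, and let $J$ and $K$ be sections of $\mathcal{C}(E)$ with $\nabla J=0$. Let $M^{\#}$ be one of $M^{(m_1,* )}$, $M^{( *,m_{-1})}$, $M^{(m_1,m_{-1})}$, let $x\in M^{\#}$, and suppose that there is a curve $\gamma$ in $M$ such that $\gamma(0)=x$, $\gamma(t)$ lies in $M^{\#}$ for small $t\in\mathbb{R}$, and $\gamma'(0)=v$. Then, at $x$: 1) for $M^{\#}=M^{(m_{1},* )}$, $\nabla_{v}K$ maps $\operatorname{Ker}(J+K)$ into $\operatorname{Im}(J+K)$; 2) for $M^{\#}=M^{( *,m_{-1})}$, $\nabla_{v}K$ maps $\operatorname{Ker}(J-K)$ into $\operatorname{Im}(J-K)$; 3) for $M^{\#}=M^{(m_{1},m_{-1})}$, $\nabla_{v}K$ maps $\operatorname{Ker}(J+K)$ into $\operatorname{Im}(J+K)$ and maps $\operatorname{Ker}(J-K)$ into $\operatorname{Im}(J-K)$.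
   Context: $\mathcal{C}(E)=\{j\in \operatorname{End}E \mid j^2=-1\}$. $M^{(m_1,* )}=\{x\in M\mid\dim_{\mathbb{R}}\operatorname{Ker}(J+K)|_x=2m_1\}$, $M^{( *,m_{-1})}=\{x\in M\mid\dim_{\mathbb{R}}\operatorname{Ker}(J-K)|_x=2m_{-1}\}$, $M^{(m_1,m_{-1})}=M^{(m_1,* )}\cap M^{( *,m_{-1})}$. No condition is imposed on $K$ or on the curvature of $\nabla$, and $M$ need not be even dimensional. Sections and curves are smooth. *)

theory Defs
  imports "HOL-Analysis.Analysis"
begin

section \<open>Smooth maps between normed spaces\<close>

text \<open>To be used on open sets and finite-dimensional domains, where being \<open>C\<^sup>k\<close> amounts to
  continuity of all iterated directional derivatives.\<close>

primrec Ck_on :: "nat \<Rightarrow> 'a::real_normed_vector set \<Rightarrow> ('a \<Rightarrow> 'b::real_normed_vector) \<Rightarrow> bool" where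
  "Ck_on 0 S f \<longleftrightarrow> continuous_on S f"
| "Ck_on (Suc k) S f \<longleftrightarrow> (\<forall>x\<in>S. f differentiable (at x)) \<and>
     (\<forall>h. Ck_on k S (\<lambda>x. frechet_derivative f (at x) h))"

definition smooth_on :: "'a::real_normed_vector set \<Rightarrow> ('a \<Rightarrow> 'b::real_normed_vector) \<Rightarrow> bool" where
  "smooth_on S f \<longleftrightarrow> (\<forall>k. Ck_on k S f)"


section \<open>Smooth manifolds\<close>

text \<open>A manifold is a whole type \<open>'m\<close>, Hausdorff and second countable by its sort, with an atlas
  that need not be maximal. The model space is a finite-dimensional inner product space;
  the sort \<^class>\<open>euclidean_space\<close> is not used because it excludes dimension 0.\<close>

type_synonym ('m, 'e) atlas = "('m set \<times> ('m \<Rightarrow> 'e)) set"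

definition smooth_manifold ::
  "('m::{t2_space,second_countable_topology}, 'e::real_inner) atlas \<Rightarrow> bool" where
  "smooth_manifold A \<longleftrightarrow>
     (\<exists>B::'e set. finite B \<and> span B = UNIV) \<and>
     (\<Union>(U, \<phi>)\<in>A. U) = UNIV \<and>
     (\<forall>(U, \<phi>)\<in>A. open U \<and> open (\<phi> ` U) \<and> homeomorphism U (\<phi> ` U) \<phi> (inv_into U \<phi>)) \<and>
     (\<forall>(U, \<phi>)\<in>A. \<forall>(V, \<psi>)\<in>A. smooth_on (\<phi> ` (U \<inter> V)) (\<psi> \<circ> inv_into U \<phi>))"

definition smooth_fun_on :: "('m, 'e::real_inner) atlas \<Rightarrow> 'm set \<Rightarrow> ('m \<Rightarrow> real) \<Rightarrow> bool" where
  "smooth_fun_on A W f \<longleftrightarrow> (\<forall>(U, \<phi>)\<in>A. smooth_on (\<phi> ` (U \<inter> W)) (f \<circ> inv_into U \<phi>))"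

abbreviation smooth_fun :: "('m, 'e::real_inner) atlas \<Rightarrow> ('m \<Rightarrow> real) \<Rightarrow> bool" where
  "smooth_fun A \<equiv> smooth_fun_on A UNIV"

text \<open>Tangent vectors are derivations of the algebra of smooth functions on the manifold, set to 0
  on the other functions so that equal tangent vectors are equal in HOL.\<close>

type_synonym 'm tangent = "('m \<Rightarrow> real) \<Rightarrow> real"

definition tangent_space :: "('m, 'e::real_inner) atlas \<Rightarrow> 'm \<Rightarrow> 'm tangent set" where
  "tangent_space A x = {v.
     (\<forall>f g. smooth_fun A f \<longrightarrow> smooth_fun A g \<longrightarrow> v (\<lambda>y. f y + g y) = v f + v g) \<and>
     (\<forall>c f. smooth_fun A f \<longrightarrow> v (\<lambda>y. c * f y) = c * v f) \<and>
     (\<forall>f g. smooth_fun A f \<longrightarrow> smooth_fun A g \<longrightarrow> v (\<lambda>y. f y * g y) = v f * g x + f x * v g) \<and>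
     (\<forall>f. \<not> smooth_fun A f \<longrightarrow> v f = 0)}"

definition smooth_vector_field :: "('m, 'e::real_inner) atlas \<Rightarrow> ('m \<Rightarrow> 'm tangent) \<Rightarrow> bool" where
  "smooth_vector_field A X \<longleftrightarrow> (\<forall>x. X x \<in> tangent_space A x) \<and>
     (\<forall>f. smooth_fun A f \<longrightarrow> smooth_fun A (\<lambda>x. X x f))"

definition smooth_curve ::
  "('m::topological_space, 'e::real_inner) atlas \<Rightarrow> real set \<Rightarrow> (real \<Rightarrow> 'm) \<Rightarrow> bool" where
  "smooth_curve A I \<gamma> \<longleftrightarrow> open I \<and> is_interval I \<and> continuous_on I \<gamma> \<and>
     (\<forall>(U, \<phi>)\<in>A. smooth_on {t \<in> I. \<gamma> t \<in> U} (\<phi> \<circ> \<gamma>))"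

definition velocity :: "('m, 'e::real_inner) atlas \<Rightarrow> (real \<Rightarrow> 'm) \<Rightarrow> real \<Rightarrow> 'm tangent" where
  "velocity A \<gamma> t = (\<lambda>f. if smooth_fun A f then deriv (f \<circ> \<gamma>) t else 0)"


section \<open>Real vector bundles\<close>

text \<open>The fibres \<open>E x\<close> are subspaces of a real vector space type \<open>'v\<close>. That type has no topology and
  only serves as a container (e.g. the algebraic direct sum of all fibres); fibres over different
  points are unrelated in it. The bundle structure is carried by a bundle atlas \<open>T\<close> of local
  trivialisations \<open>(U, \<tau>)\<close>, where \<open>\<tau> x\<close> sends the fibre over \<open>x \<in> U\<close> linearly and bijectively to
  \<open>\<real>\<^sup>r\<close>, realised as the sequences vanishing from index \<open>r\<close> on; the transition functions are
  smooth matrices.\<close>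

type_synonym ('m, 'v) bundle_atlas = "('m set \<times> ('m \<Rightarrow> 'v \<Rightarrow> nat \<Rightarrow> real)) set"

definition vector_bundle ::
  "('m::{t2_space,second_countable_topology}, 'e::real_inner) atlas \<Rightarrow> nat \<Rightarrow>
     ('m \<Rightarrow> 'v::real_vector set) \<Rightarrow> ('m, 'v) bundle_atlas \<Rightarrow> bool" where
  "vector_bundle A r E T \<longleftrightarrow>
     (\<forall>x. subspace (E x)) \<and>
     (\<Union>(U, \<tau>)\<in>T. U) = UNIV \<and>
     (\<forall>(U, \<tau>)\<in>T. open U \<and>
        (\<forall>x\<in>U. bij_betw (\<tau> x) (E x) {c. \<forall>i\<ge>r. c i = 0} \<and>
          (\<forall>u\<in>E x. \<forall>w\<in>E x. \<forall>i. \<tau> x (u + w) i = \<tau> x u i + \<tau> x w i) \<and>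
          (\<forall>u\<in>E x. \<forall>a i. \<tau> x (a *\<^sub>R u) i = a * \<tau> x u i))) \<and>
     (\<forall>(U, \<tau>)\<in>T. \<forall>(V, \<sigma>)\<in>T. \<exists>g :: nat \<Rightarrow> nat \<Rightarrow> 'm \<Rightarrow> real.
        (\<forall>i<r. \<forall>j<r. smooth_fun_on A (U \<inter> V) (g i j)) \<and>
        (\<forall>x\<in>U \<inter> V. \<forall>u\<in>E x. \<forall>i<r. \<sigma> x u i = (\<Sum>j<r. g i j x * \<tau> x u j)))"

definition smooth_section ::
  "('m, 'e::real_inner) atlas \<Rightarrow> nat \<Rightarrow> ('m \<Rightarrow> 'v::real_vector set) \<Rightarrow> ('m, 'v) bundle_atlas \<Rightarrow>
     ('m \<Rightarrow> 'v) \<Rightarrow> bool" where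
  "smooth_section A r E T s \<longleftrightarrow> (\<forall>x. s x \<in> E x) \<and>
     (\<forall>(U, \<tau>)\<in>T. \<forall>i<r. smooth_fun_on A U (\<lambda>x. \<tau> x (s x) i))"

text \<open>Endomorphisms of a subspace \<open>V\<close> are functions on the whole type, of which only the values on
  \<open>V\<close> matter.\<close>

definition endomorphisms :: "'v::real_vector set \<Rightarrow> ('v \<Rightarrow> 'v) set" where
  "endomorphisms V = {L. (\<forall>u\<in>V. L u \<in> V) \<and>
     (\<forall>u\<in>V. \<forall>w\<in>V. L (u + w) = L u + L w) \<and> (\<forall>u\<in>V. \<forall>a. L (a *\<^sub>R u) = a *\<^sub>R L u)}"

definition complex_structures :: "'v::real_vector set \<Rightarrow> ('v \<Rightarrow> 'v) set" where
  "complex_structures V = {j \<in> endomorphisms V. \<forall>u\<in>V. j (j u) = - u}"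

definition smooth_End_section ::
  "('m, 'e::real_inner) atlas \<Rightarrow> nat \<Rightarrow> ('m \<Rightarrow> 'v::real_vector set) \<Rightarrow> ('m, 'v) bundle_atlas \<Rightarrow>
     ('m \<Rightarrow> 'v \<Rightarrow> 'v) \<Rightarrow> bool" where
  "smooth_End_section A r E T L \<longleftrightarrow> (\<forall>x. L x \<in> endomorphisms (E x)) \<and>
     (\<forall>(U, \<tau>)\<in>T. \<exists>a :: nat \<Rightarrow> nat \<Rightarrow> 'm \<Rightarrow> real.
        (\<forall>i<r. \<forall>j<r. smooth_fun_on A U (a i j)) \<and>
        (\<forall>x\<in>U. \<forall>u\<in>E x. \<forall>i<r. \<tau> x (L x u) i = (\<Sum>j<r. a i j x * \<tau> x u j)))"

definition smooth_complex_structure ::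
  "('m, 'e::real_inner) atlas \<Rightarrow> nat \<Rightarrow> ('m \<Rightarrow> 'v::real_vector set) \<Rightarrow> ('m, 'v) bundle_atlas \<Rightarrow>
     ('m \<Rightarrow> 'v \<Rightarrow> 'v) \<Rightarrow> bool" where
  "smooth_complex_structure A r E T J \<longleftrightarrow>
     smooth_End_section A r E T J \<and> (\<forall>x. J x \<in> complex_structures (E x))"


section \<open>Connections\<close>

text \<open>\<open>D x v s\<close> is the covariant derivative at \<open>x\<close> of the section \<open>s\<close> along \<open>v\<close> tangent at \<open>x\<close>. Thus
  \<open>D\<close> takes a section of \<open>E\<close> to a section of the bundle of homomorphisms from the tangent bundle
  to \<open>E\<close>. Homogeneity in \<open>s\<close> is the Leibniz rule for a constant function.\<close>

type_synonym ('m, 'v) covariant_derivative = "'m \<Rightarrow> 'm tangent \<Rightarrow> ('m \<Rightarrow> 'v) \<Rightarrow> 'v"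

definition connection ::
  "('m, 'e::real_inner) atlas \<Rightarrow> nat \<Rightarrow> ('m \<Rightarrow> 'v::real_vector set) \<Rightarrow> ('m, 'v) bundle_atlas \<Rightarrow>
     ('m, 'v) covariant_derivative \<Rightarrow> bool" where
  "connection A r E T D \<longleftrightarrow>
     (\<forall>x. \<forall>v\<in>tangent_space A x. \<forall>w\<in>tangent_space A x. \<forall>a b s. smooth_section A r E T s \<longrightarrow>
        D x (\<lambda>f. a * v f + b * w f) s = a *\<^sub>R D x v s + b *\<^sub>R D x w s) \<and>
     (\<forall>x. \<forall>v\<in>tangent_space A x. \<forall>s s'. smooth_section A r E T s \<longrightarrow> smooth_section A r E T s' \<longrightarrow>
        D x v (\<lambda>y. s y + s' y) = D x v s + D x v s') \<and>
     (\<forall>x. \<forall>v\<in>tangent_space A x. \<forall>f s. smooth_fun A f \<longrightarrow> smooth_section A r E T s \<longrightarrow>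
        D x v (\<lambda>y. f y *\<^sub>R s y) = v f *\<^sub>R s x + f x *\<^sub>R D x v s) \<and>
     (\<forall>x. \<forall>v\<in>tangent_space A x. \<forall>s. smooth_section A r E T s \<longrightarrow> D x v s \<in> E x) \<and>
     (\<forall>X s. smooth_vector_field A X \<longrightarrow> smooth_section A r E T s \<longrightarrow>
        smooth_section A r E T (\<lambda>x. D x (X x) s))"

text \<open>The induced connection on \<open>End E\<close>, \<open>(\<nabla>\<^sub>v L) s = \<nabla>\<^sub>v (L s) - L (\<nabla>\<^sub>v s)\<close>. By the Leibniz rule the
  right-hand side depends on \<open>s\<close> only through its value \<open>u\<close> at \<open>x\<close>, and every \<open>u\<close> in the fibre is
  the value of some section, so the description is proper.\<close>

definition nabla_End ::
  "('m, 'e::real_inner) atlas \<Rightarrow> nat \<Rightarrow> ('m \<Rightarrow> 'v::real_vector set) \<Rightarrow> ('m, 'v) bundle_atlas \<Rightarrow>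
     ('m, 'v) covariant_derivative \<Rightarrow> 'm \<Rightarrow> 'm tangent \<Rightarrow> ('m \<Rightarrow> 'v \<Rightarrow> 'v) \<Rightarrow> 'v \<Rightarrow> 'v" where
  "nabla_End A r E T D x v L u =
     (THE w. \<forall>s. smooth_section A r E T s \<longrightarrow> s x = u \<longrightarrow>
        w = D x v (\<lambda>y. L y (s y)) - L x (D x v s))"

definition parallel_End ::
  "('m, 'e::real_inner) atlas \<Rightarrow> nat \<Rightarrow> ('m \<Rightarrow> 'v::real_vector set) \<Rightarrow> ('m, 'v) bundle_atlas \<Rightarrow>
     ('m, 'v) covariant_derivative \<Rightarrow> ('m \<Rightarrow> 'v \<Rightarrow> 'v) \<Rightarrow> bool" where
  "parallel_End A r E T D L \<longleftrightarrow>
     (\<forall>x. \<forall>v\<in>tangent_space A x. \<forall>u\<in>E x. nabla_End A r E T D x v L u = 0)"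


section \<open>The kernels and images of \<open>J + K\<close> and \<open>J - K\<close>, and the strata\<close>

definition Ker_plus ::
  "('m \<Rightarrow> 'v::real_vector set) \<Rightarrow> ('m \<Rightarrow> 'v \<Rightarrow> 'v) \<Rightarrow> ('m \<Rightarrow> 'v \<Rightarrow> 'v) \<Rightarrow> 'm \<Rightarrow> 'v set" where
  "Ker_plus E J K x = {u \<in> E x. J x u + K x u = 0}"

definition Ker_minus ::
  "('m \<Rightarrow> 'v::real_vector set) \<Rightarrow> ('m \<Rightarrow> 'v \<Rightarrow> 'v) \<Rightarrow> ('m \<Rightarrow> 'v \<Rightarrow> 'v) \<Rightarrow> 'm \<Rightarrow> 'v set" where
  "Ker_minus E J K x = {u \<in> E x. J x u - K x u = 0}"

definition Im_plus ::
  "('m \<Rightarrow> 'v::real_vector set) \<Rightarrow> ('m \<Rightarrow> 'v \<Rightarrow> 'v) \<Rightarrow> ('m \<Rightarrow> 'v \<Rightarrow> 'v) \<Rightarrow> 'm \<Rightarrow> 'v set" where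
  "Im_plus E J K x = (\<lambda>u. J x u + K x u) ` E x"

definition Im_minus ::
  "('m \<Rightarrow> 'v::real_vector set) \<Rightarrow> ('m \<Rightarrow> 'v \<Rightarrow> 'v) \<Rightarrow> ('m \<Rightarrow> 'v \<Rightarrow> 'v) \<Rightarrow> 'm \<Rightarrow> 'v set" where
  "Im_minus E J K x = (\<lambda>u. J x u - K x u) ` E x"

definition M_plus ::
  "('m \<Rightarrow> 'v::real_vector set) \<Rightarrow> ('m \<Rightarrow> 'v \<Rightarrow> 'v) \<Rightarrow> ('m \<Rightarrow> 'v \<Rightarrow> 'v) \<Rightarrow> nat \<Rightarrow> 'm set" where
  "M_plus E J K m\<^sub>1 = {x. dim (Ker_plus E J K x) = 2 * m\<^sub>1}"

definition M_minus ::
  "('m \<Rightarrow> 'v::real_vector set) \<Rightarrow> ('m \<Rightarrow> 'v \<Rightarrow> 'v) \<Rightarrow> ('m \<Rightarrow> 'v \<Rightarrow> 'v) \<Rightarrow> nat \<Rightarrow> 'm set" where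
  "M_minus E J K m\<^sub>2 = {x. dim (Ker_minus E J K x) = 2 * m\<^sub>2}"

definition M_both ::
  "('m \<Rightarrow> 'v::real_vector set) \<Rightarrow> ('m \<Rightarrow> 'v \<Rightarrow> 'v) \<Rightarrow> ('m \<Rightarrow> 'v \<Rightarrow> 'v) \<Rightarrow> nat \<Rightarrow> nat \<Rightarrow> 'm set" where
  "M_both E J K m\<^sub>1 m\<^sub>2 = M_plus E J K m\<^sub>1 \<inter> M_minus E J K m\<^sub>2"

text \<open>The curve hypothesis for a subset \<open>N\<close> of the manifold: \<open>v\<close> is the velocity at 0 of a curve
  that starts at \<open>x\<close> and stays in \<open>N\<close> for small parameters of either sign.\<close>

definition curve_through ::
  "('m::topological_space, 'e::real_inner) atlas \<Rightarrow> 'm set \<Rightarrow> 'm \<Rightarrow> 'm tangent \<Rightarrow> bool" where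
  "curve_through A N x v \<longleftrightarrow> (\<exists>I \<gamma>. smooth_curve A I \<gamma> \<and> 0 \<in> I \<and> \<gamma> 0 = x \<and>
     (\<forall>\<^sub>F t in nhds 0. \<gamma> t \<in> N) \<and> velocity A \<gamma> 0 = v)"

end

theory Submission
  imports Defs
begin

text \<open>The endomorphism field that matters is \<open>P = J + c K\<close> with \<open>c = 1\<close> or \<open>c = - 1\<close>. Since \<open>J\<close> is
  parallel, \<open>\<nabla>\<^sub>v P = c \<nabla>\<^sub>v K\<close>, so the claim is about \<open>P\<close> alone: if the dimension of \<open>Ker P\<close> is constant
  along a curve with velocity \<open>v\<close> at \<open>x\<close>, then \<open>\<nabla>\<^sub>v P\<close> maps \<open>Ker P\<close> into \<open>Im P\<close> at \<open>x\<close>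
  (\<open>nabla_maps_kernel_into_range\<close>).

  The geometric half reduces the claim to matrices. Let \<open>u \<in> Ker P\<close> at \<open>x\<close> and let \<open>s\<close> be a section with
  value \<open>u\<close> at \<open>x\<close>. Then \<open>(\<nabla>\<^sub>v P) u = \<nabla>\<^sub>v (P s) - P (\<nabla>\<^sub>v s)\<close>, and the last term lies in \<open>Im P\<close>. The
  section \<open>P s\<close> vanishes at \<open>x\<close>, so its covariant derivative is simply the derivative of its components
  along the curve, whatever the connection (\<open>D_of_section_vanishing_at\<close>). Taking \<open>s\<close> to have constant
  components, up to a cut-off factor, shows that \<open>\<nabla>\<^sub>v (P s)\<close> is the derivative at \<open>0\<close> of \<open>B t u\<close>, where
  \<open>B t\<close> is the matrix of \<open>P\<close> at the point \<open>\<gamma> t\<close> of the curve.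

  The algebraic half is \<open>derivative_in_range_of_const_nullity\<close>: if the nullity of \<open>B t\<close> does not drop near
  \<open>0\<close> and \<open>B 0 u = 0\<close>, then the derivative \<open>b\<close> of \<open>B t u\<close> at \<open>0\<close> lies in the range of \<open>B 0\<close>. Otherwise,
  choose vectors \<open>w\<^sub>1, \<dots>, w\<^sub>k\<close> whose images form a basis of the range of \<open>B 0\<close>; together with \<open>b\<close> these
  images are independent. For small \<open>t \<noteq> 0\<close> the vectors \<open>B t w\<^sub>i\<close> are close to \<open>B 0 w\<^sub>i\<close> and \<open>B t u / t\<close> is
  close to \<open>b\<close>, so they are independent as well, and the rank of \<open>B t\<close> exceeds that of \<open>B 0\<close>,
  contrary to the assumption on the nullity.

  A connection acts on global sections only. Bump functions on the manifold supply the global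
  sections with prescribed values and the global frames in which sections are expanded.\<close>

section \<open>Calculus of smooth maps on open sets\<close>

lemma Ck_on_subset:
  "Ck_on k S f \<Longrightarrow> S' \<subseteq> S \<Longrightarrow> Ck_on k S' f"
  by (induction k arbitrary: f) (auto intro: continuous_on_subset)

text \<open>Openness of \<open>S\<close> makes the derivatives at points of \<open>S\<close> depend on the values on \<open>S\<close> alone.\<close>

lemma Ck_on_cong:
  assumes "open S" "\<And>x. x \<in> S \<Longrightarrow> f x = g x" "Ck_on k S f"
  shows "Ck_on k S g"
  using assms(2,3)
proof (induction k arbitrary: f g)
  case 0
  then show ?case using continuous_on_cong[of S S f g] by simp
next
  case (Suc k)
  have diff: "f differentiable (at x)" if "x \<in> S" for x
    using Suc.prems that by simp
  have "frechet_derivative f (at x) = frechet_derivative g (at x)" if "x \<in> S" for x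
    using frechet_derivative_transform_within_open[OF diff[OF that] assms(1) that] Suc.prems(1)
    by blast
  moreover have "g differentiable (at x)" if "x \<in> S" for x
    using diff[OF that] has_derivative_transform_within_open[of f _ x UNIV S g] assms(1) that
      Suc.prems(1) unfolding differentiable_def by blast
  moreover have "Ck_on k S (\<lambda>x. frechet_derivative g (at x) h)" for h
    by (rule Suc.IH[of "\<lambda>x. frechet_derivative f (at x) h"])
      (use Suc.prems(2) calculation(1) in auto)
  ultimately show ?case by simp
qed

lemma Ck_on_Suc_imp: "Ck_on (Suc k) S f \<Longrightarrow> Ck_on k S f"
proof (induction k arbitrary: f)
  case 0
  then show ?case
    by (auto intro!: continuous_at_imp_continuous_on differentiable_imp_continuous_within)
next
  case (Suc k)
  then show ?case by (metis Ck_on.simps(2))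
qed

lemma Ck_on_Un: "open S \<Longrightarrow> open S' \<Longrightarrow> Ck_on k S f \<Longrightarrow> Ck_on k S' f \<Longrightarrow> Ck_on k (S \<union> S') f"
  by (induction k arbitrary: f) (auto intro: continuous_on_open_Un)

lemma Ck_on_const: "Ck_on k S (\<lambda>x. c)"
  by (induction k arbitrary: c) (auto simp: continuous_on_const)

lemma Ck_on_add:
  assumes "open S" "Ck_on k S f" "Ck_on k S g"
  shows "Ck_on k S (\<lambda>x. f x + g x)"
  using assms(2,3)
proof (induction k arbitrary: f g)
  case 0
  then show ?case by (simp add: continuous_on_add)
next
  case (Suc k)
  have *: "((\<lambda>x. f x + g x) has_derivative
      (\<lambda>h. frechet_derivative f (at x) h + frechet_derivative g (at x) h)) (at x)" if "x \<in> S" for x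
    using Suc.prems that by (auto intro!: has_derivative_add simp: frechet_derivative_works[symmetric])
  have "Ck_on k S (\<lambda>x. frechet_derivative f (at x) h + frechet_derivative g (at x) h)" for h
    using Suc.prems by (auto intro: Suc.IH)
  then have "Ck_on k S (\<lambda>x. frechet_derivative (\<lambda>x. f x + g x) (at x) h)" for h
    by (rule Ck_on_cong[OF assms(1), rotated]) (simp flip: frechet_derivative_at[OF *])
  then show ?case
    using * by (auto simp: differentiable_def)
qed

lemma Ck_on_bilinear:
  assumes "bounded_bilinear b" "open S" "Ck_on k S f" "Ck_on k S g"
  shows "Ck_on k S (\<lambda>x. b (f x) (g x))"
  using assms(3,4)
proof (induction k arbitrary: f g)
  case 0
  then show ?case by (simp add: bounded_bilinear.continuous_on[OF assms(1)])
next
  case (Suc k)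
  have *: "((\<lambda>x. b (f x) (g x)) has_derivative
      (\<lambda>h. b (f x) (frechet_derivative g (at x) h) + b (frechet_derivative f (at x) h) (g x))) (at x)"
    if "x \<in> S" for x
    using Suc.prems that
    by (auto intro!: bounded_bilinear.FDERIV[OF assms(1)] simp: frechet_derivative_works[symmetric])
  have "Ck_on k S (\<lambda>x. b (f x) (frechet_derivative g (at x) h) + b (frechet_derivative f (at x) h) (g x))" for h
    using Suc.prems Ck_on_Suc_imp[OF Suc.prems(1)] Ck_on_Suc_imp[OF Suc.prems(2)]
    by (auto intro!: Ck_on_add assms Suc.IH)
  then have "Ck_on k S (\<lambda>x. frechet_derivative (\<lambda>x. b (f x) (g x)) (at x) h)" for h
    by (rule Ck_on_cong[OF assms(2), rotated]) (simp flip: frechet_derivative_at[OF *])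
  then show ?case
    using * by (auto simp: differentiable_def)
qed

text \<open>A family closed under differentiation can be composed with any \<open>C\<^sup>k\<close> function: by the chain rule,
  a derivative of \<open>F i \<circ> q\<close> is a product of \<open>F (d i) \<circ> q\<close> with a derivative of \<open>q\<close>, which lets the
  induction on \<open>k\<close> run over all members of the family at once. Bump functions have the
  form \<open>F i \<circ> q\<close>.\<close>

lemma Ck_on_chain:
  fixes F :: "'i \<Rightarrow> real \<Rightarrow> real"
  assumes "\<And>i t. (F i has_real_derivative F (d i) t) (at t)" "open S" "Ck_on k S q"
  shows "Ck_on k S (\<lambda>x. F i (q x))"
  using assms(3)
proof (induction k arbitrary: i)
  case 0
  have "continuous_on UNIV (F i)"
    using assms(1) by (meson DERIV_continuous_on has_field_derivative_at_within)
  with 0 show ?case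
    by (auto intro: continuous_on_compose2)
next
  case (Suc k)
  have *: "((\<lambda>x. F i (q x)) has_derivative
      (\<lambda>h. F (d i) (q x) * frechet_derivative q (at x) h)) (at x)" if "x \<in> S" for x
    using Suc.prems that has_derivative_compose[of q "frechet_derivative q (at x)" x UNIV "F i"
        "\<lambda>s. F (d i) (q x) * s"] assms(1)[of i "q x"]
    by (auto simp: frechet_derivative_works[symmetric] has_field_derivative_def)
  have "Ck_on k S (\<lambda>x. F (d i) (q x) * frechet_derivative q (at x) h)" for h
    using Suc.prems Ck_on_Suc_imp[OF Suc.prems(1)]
    by (auto intro!: Ck_on_bilinear[OF bounded_bilinear_mult] assms Suc.IH)
  then have "Ck_on k S (\<lambda>x. frechet_derivative (\<lambda>x. F i (q x)) (at x) h)" for h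
    by (rule Ck_on_cong[OF assms(2), rotated, of _ "\<lambda>x. F (d i) (q x) * frechet_derivative q (at x) h"])
      (simp flip: frechet_derivative_at[OF *])
  then show ?case
    using * by (auto simp: differentiable_def)
qed

lemma smooth_on_subset: "smooth_on S f \<Longrightarrow> S' \<subseteq> S \<Longrightarrow> smooth_on S' f"
  unfolding smooth_on_def using Ck_on_subset by blast

lemma smooth_on_cong:
  "open S \<Longrightarrow> (\<And>x. x \<in> S \<Longrightarrow> f x = g x) \<Longrightarrow> smooth_on S f \<Longrightarrow> smooth_on S g"
  unfolding smooth_on_def using Ck_on_cong by blast

lemma smooth_on_Un:
  "open S \<Longrightarrow> open S' \<Longrightarrow> smooth_on S f \<Longrightarrow> smooth_on S' f \<Longrightarrow> smooth_on (S \<union> S') f"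
  unfolding smooth_on_def using Ck_on_Un by blast

lemma smooth_on_const: "smooth_on S (\<lambda>x. c)"
  unfolding smooth_on_def using Ck_on_const by blast

lemma smooth_on_add:
  "open S \<Longrightarrow> smooth_on S f \<Longrightarrow> smooth_on S g \<Longrightarrow> smooth_on S (\<lambda>x. f x + g x)"
  unfolding smooth_on_def using Ck_on_add by blast

lemma smooth_on_bilinear:
  "bounded_bilinear b \<Longrightarrow> open S \<Longrightarrow> smooth_on S f \<Longrightarrow> smooth_on S g \<Longrightarrow>
    smooth_on S (\<lambda>x. b (f x) (g x))"
  unfolding smooth_on_def using Ck_on_bilinear by blast

lemma smooth_on_imp_differentiable: "smooth_on S f \<Longrightarrow> x \<in> S \<Longrightarrow> f differentiable (at x)"
  unfolding smooth_on_def using Ck_on.simps(2)[of 0] by blast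

subsection \<open>A flat function\<close>

text \<open>The function \<open>exp (- 1 / t)\<close>, extended by zero, is the case \<open>p = 1\<close>. The polynomial factor closes
  the family under differentiation.\<close>

definition flat_exp :: "real poly \<Rightarrow> real \<Rightarrow> real" where
  "flat_exp p t = (if t \<le> 0 then 0 else poly p (inverse t) * exp (- inverse t))"

lemma poly_exp_minus_tendsto_0: "((\<lambda>x. poly p x * exp (- x)) \<longlongrightarrow> (0::real)) at_top"
proof -
  have "((\<lambda>x. \<Sum>i\<le>degree p. coeff p i * (x ^ i / exp x)) \<longlongrightarrow> (\<Sum>i\<le>degree p. coeff p i * 0)) at_top"
    by (intro tendsto_intros tendsto_power_div_exp_0)
  then show ?thesis
    by (simp add: poly_altdef exp_minus field_simps sum_divide_distrib)
qed

lemma flat_exp_has_derivative: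
  "(flat_exp p has_real_derivative flat_exp ([:0, 0, 1:] * (p - pderiv p)) t) (at t)"
proof -
  consider "t < 0" | "t > 0" | "t = 0" by linarith
  then show ?thesis
  proof cases
    case 1
    have "((\<lambda>_. 0) has_real_derivative flat_exp ([:0, 0, 1:] * (p - pderiv p)) t) (at t)"
      using 1 by (simp add: flat_exp_def)
    then show ?thesis
      by (rule has_field_derivative_transform_within_open[of _ _ _ "{..<0}"])
        (use 1 in \<open>auto simp: flat_exp_def\<close>)
  next
    case 2
    have "((\<lambda>t. poly p (inverse t) * exp (- inverse t)) has_real_derivative
        flat_exp ([:0, 0, 1:] * (p - pderiv p)) t) (at t)"
      using 2 by (auto intro!: derivative_eq_intros DERIV_chain2[OF poly_DERIV]
          simp: flat_exp_def algebra_simps power2_eq_square)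
    then show ?thesis
      by (rule has_field_derivative_transform_within_open[of _ _ _ "{0<..}"])
        (use 2 in \<open>auto simp: flat_exp_def\<close>)
  next
    case 3
    \<comment> \<open>The difference quotient at 0 belongs to the family itself, with \<open>p\<close> multiplied by the variable.\<close>
    have "((\<lambda>t. poly ([:0, 1:] * p) (inverse t) * exp (- inverse t)) \<longlongrightarrow> 0) (at_right (0::real))"
      using filterlim_compose[OF poly_exp_minus_tendsto_0 filterlim_inverse_at_top_right] .
    then have "((\<lambda>t. flat_exp p t / t) \<longlongrightarrow> 0) (at_right 0)"
      by (rule Lim_transform_eventually)
        (auto simp: flat_exp_def eventually_at_right_less field_simps
          intro!: eventually_mono[OF eventually_at_right_less])
    moreover have "((\<lambda>t. flat_exp p t / t) \<longlongrightarrow> 0) (at_left 0)"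
      by (rule Lim_transform_eventually[OF tendsto_const])
        (auto simp: flat_exp_def eventually_at_filter)
    ultimately have "((\<lambda>t. flat_exp p t / t) \<longlongrightarrow> 0) (at 0)"
      by (simp add: filterlim_split_at)
    then show ?thesis
      using 3 by (simp add: has_field_derivative_iff flat_exp_def)
  qed
qed

section \<open>Compact balls\<close>

lemma compact_scaled_sums:
  fixes C :: "'e::real_normed_vector set"
  assumes "finite C"
  shows "compact {\<Sum>b\<in>C. c b *\<^sub>R b | c. \<forall>b\<in>C. \<bar>c b\<bar> \<le> (R b :: real)}"
  using assms
proof (induction C)
  case empty
  then show ?case by simp
next
  case (insert a C)
  let ?S = "{\<Sum>b\<in>C. c b *\<^sub>R b | c. \<forall>b\<in>C. \<bar>c b\<bar> \<le> R b}"
  have "compact ((\<lambda>s. s *\<^sub>R a) ` {- R a..R a})"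
    by (intro compact_continuous_image continuous_intros) auto
  with insert.IH have "compact {x + y |x y. x \<in> (\<lambda>s. s *\<^sub>R a) ` {- R a..R a} \<and> y \<in> ?S}"
    by (rule compact_sums[rotated])
  moreover have "{x + y |x y. x \<in> (\<lambda>s. s *\<^sub>R a) ` {- R a..R a} \<and> y \<in> ?S} =
      {\<Sum>b\<in>insert a C. c b *\<^sub>R b | c. \<forall>b\<in>insert a C. \<bar>c b\<bar> \<le> R b}" (is "?L = ?R")
  proof
    show "?L \<subseteq> ?R"
    proof clarsimp
      fix s c assume s: "- R a \<le> s" "s \<le> R a" and c: "\<forall>b\<in>C. \<bar>c b\<bar> \<le> R b"
      have "(\<Sum>b\<in>C. (c(a := s)) b *\<^sub>R b) = (\<Sum>b\<in>C. c b *\<^sub>R b)"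
        using insert.hyps by (intro sum.cong) auto
      then show "\<exists>ca. s *\<^sub>R a + (\<Sum>b\<in>C. c b *\<^sub>R b) = (\<Sum>b\<in>insert a C. ca b *\<^sub>R b) \<and>
          \<bar>ca a\<bar> \<le> R a \<and> (\<forall>b\<in>C. \<bar>ca b\<bar> \<le> R b)"
        using s c insert.hyps by (intro exI[of _ "c(a := s)"]) auto
    qed
    show "?R \<subseteq> ?L"
    proof clarsimp
      fix c assume c: "\<bar>c a\<bar> \<le> R a" "\<forall>b\<in>C. \<bar>c b\<bar> \<le> R b"
      show "\<exists>x y. (\<Sum>b\<in>insert a C. c b *\<^sub>R b) = x + y \<and> x \<in> (\<lambda>s. s *\<^sub>R a) ` {- R a..R a} \<and>
           (\<exists>c. y = (\<Sum>b\<in>C. c b *\<^sub>R b) \<and> (\<forall>b\<in>C. \<bar>c b\<bar> \<le> R b))"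
        using c insert.hyps
        by (intro exI[of _ "c a *\<^sub>R a"] exI[of _ "\<Sum>b\<in>C. c b *\<^sub>R b"] conjI imageI exI[of _ c]) auto
    qed
  qed
  ultimately show ?case by simp
qed

text \<open>The sort of \<open>'e\<close> does not provide compactness of balls. With respect to an orthogonal spanning set the
  coordinates of a point are bounded by its norm, so a ball is a closed subset of a compact box.\<close>

lemma compact_cball_finite_span:
  fixes B :: "'e::real_inner set"
  assumes "finite B" "span B = UNIV"
  shows "compact (cball (p::'e) r)"
proof -
  obtain C :: "'e set" where C: "finite C" "span C = span B" "pairwise orthogonal C"
    using basis_orthogonal[OF assms(1)] by blast
  let ?S = "{\<Sum>b\<in>C. c b *\<^sub>R b | c. \<forall>b\<in>C. \<bar>c b\<bar> \<le> r / norm b}"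
  have "cball 0 r \<subseteq> ?S"
  proof
    fix x :: 'e assume x: "x \<in> cball 0 r"
    have "x \<in> span C" using C assms by simp
    then obtain c where c: "x = (\<Sum>b\<in>C. c b *\<^sub>R b)"
      unfolding span_finite[OF C(1)] by auto
    have ip: "x \<bullet> b = c b * (b \<bullet> b)" if "b \<in> C" for b
    proof -
      have "x \<bullet> b = (\<Sum>a\<in>C. if a = b then c b * (b \<bullet> b) else 0)"
        unfolding c inner_sum_left using C(3) that
        by (intro sum.cong) (auto simp: pairwise_def orthogonal_def)
      then show ?thesis using C(1) that by simp
    qed
    \<comment> \<open>The orthogonal set may contain 0, whose coefficient is arbitrary.\<close>
    define d where "d b = (if b = 0 then 0 else c b)" for b
    have "x = (\<Sum>b\<in>C. d b *\<^sub>R b)"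
      unfolding c d_def by (intro sum.cong) auto
    moreover have "\<bar>d b\<bar> \<le> r / norm b" if "b \<in> C" for b
    proof (cases "b = 0")
      case False
      have "\<bar>d b\<bar> * norm b * norm b = \<bar>x \<bullet> b\<bar>"
        using False ip[OF that]
        by (simp add: d_def abs_mult power2_norm_eq_inner[symmetric] power2_eq_square mult.assoc)
      also have "\<dots> \<le> norm x * norm b" by (rule Cauchy_Schwarz_ineq2)
      also have "\<dots> \<le> r * norm b" using x by (simp add: mult_right_mono)
      finally show ?thesis using False by (simp add: field_simps)
    qed (simp add: d_def)
    ultimately show "x \<in> ?S" by blast
  qed
  then have "compact (cball (0::'e) r)"
    using closed_Int_compact[OF closed_cball[of "0::'e" r] compact_scaled_sums[OF C(1)], of "\<lambda>b. r / norm b"]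
    by (simp add: Int_absorb2)
  then have "compact ((+) p ` cball 0 r)"
    by (rule compact_translation)
  then show ?thesis by (simp add: image_add_cball)
qed

section \<open>Linear maps of constant nullity\<close>

lemma linear_on_sum:
  fixes L :: "'v::real_vector \<Rightarrow> 'w::real_vector"
  assumes "subspace F" "\<And>u w. u \<in> F \<Longrightarrow> w \<in> F \<Longrightarrow> L (u + w) = L u + L w"
    "\<And>u a. u \<in> F \<Longrightarrow> L (a *\<^sub>R u) = a *\<^sub>R (L u)" "finite I" "\<And>i. i \<in> I \<Longrightarrow> g i \<in> F"
  shows "L (\<Sum>i\<in>I. c i *\<^sub>R g i) = (\<Sum>i\<in>I. c i *\<^sub>R L (g i))"
  using assms(4,5)
proof (induction I)
  case empty
  have "L (0 *\<^sub>R 0) = 0 *\<^sub>R L 0" using assms(1) by (intro assms(3) subspace_0)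
  then show ?case by simp
next
  case (insert i I)
  have "(\<Sum>i\<in>I. c i *\<^sub>R g i) \<in> F"
    using insert.prems by (intro subspace_sum[OF assms(1)] subspace_scale[OF assms(1)]) auto
  moreover have "c i *\<^sub>R g i \<in> F"
    using insert.prems by (intro subspace_scale[OF assms(1)]) auto
  ultimately show ?case
    using insert.IH insert.hyps insert.prems by (simp add: assms(2,3))
qed

text \<open>Linearity is available on the subspace \<open>X\<close> only, so \<open>f\<close> is first replaced by a linear map on
  the whole space that agrees with it on \<open>X\<close>. The hypothesis that \<open>Y\<close> has a finite spanning set matters,
  since infinite dimension counts as 0.\<close>

lemma dim_le_if_linear_inj_on:
  fixes f :: "'v::real_vector \<Rightarrow> 'w::real_vector"
  assumes F: "subspace X" "\<And>u w. u \<in> X \<Longrightarrow> w \<in> X \<Longrightarrow> f (u + w) = f u + f w"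
    "\<And>u a. u \<in> X \<Longrightarrow> f (a *\<^sub>R u) = a *\<^sub>R f u"
    and inj: "inj_on f X" and into: "f ` X \<subseteq> Y" and Y: "Y \<subseteq> span S" "finite S"
  shows "dim X \<le> dim Y"
proof -
  obtain B where B: "B \<subseteq> X" "independent B" "X \<subseteq> span B" "card B = dim X"
    by (rule real_vector.basis_exists)
  obtain g where g: "linear g" "\<And>b. b \<in> B \<Longrightarrow> g b = f b"
    using linear_independent_extend[OF B(2), of f] by auto
  have span: "span B = X"
    using B F(1) by (metis span_minimal subset_antisym)
  have gf: "g x = f x" if x: "x \<in> X" for x
  proof -
    obtain T r where T: "finite T" "T \<subseteq> B" "x = (\<Sum>a\<in>T. r a *\<^sub>R a)"
      using x B(3) unfolding span_explicit by blast
    have "f x = (\<Sum>a\<in>T. r a *\<^sub>R f a)"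
      unfolding T(3) using T B by (intro linear_on_sum[OF F]) auto
    also have "\<dots> = g x"
      unfolding T(3) linear_sum[OF g(1)] using T g by (auto simp: linear_scale intro!: sum.cong)
    finally show ?thesis by simp
  qed
  have "inj_on g (span B)"
    using inj gf span by (simp add: inj_on_def)
  then have ind: "independent (g ` B)"
    using linear_independent_injective_image[OF g(1) B(2)] by blast
  obtain B' where B': "B' \<subseteq> Y" "independent B'" "Y \<subseteq> span B'" "card B' = dim Y"
    by (rule real_vector.basis_exists)
  have "finite B'"
    using real_vector.independent_span_bound[OF Y(2) B'(2)] B'(1) Y(1) by blast
  moreover have "g ` B \<subseteq> span B'"
    using B' B(1) into gf by (metis image_subset_iff subsetD)
  ultimately have "card (g ` B) \<le> card B'"
    using real_vector.independent_span_bound ind by blast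
  moreover have "card (g ` B) = card B"
    using inj_on_subset[OF \<open>inj_on g (span B)\<close>] B(1) span by (intro card_image) auto
  ultimately show ?thesis using B B' by simp
qed

text \<open>Independence is an open condition. If the matrix \<open>l i (f j)\<close> is close enough to the identity, it is
  strictly diagonally dominant, and looking at a coefficient of largest absolute value excludes a
  nontrivial relation. Only the values of finitely many functionals occur, so the vector space
  needs no topology.\<close>

lemma independent_near_biorthogonal:
  fixes f :: "'i \<Rightarrow> 'v::real_vector" and l :: "'i \<Rightarrow> 'v \<Rightarrow> real"
  assumes "finite I" and lin: "\<And>i. i \<in> I \<Longrightarrow> linear (l i)"
    and small: "\<And>i. i \<in> I \<Longrightarrow> (\<Sum>j\<in>I. \<bar>l i (f j) - (if i = j then 1 else 0)\<bar>) < 1"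
    and zero: "(\<Sum>j\<in>I. c j *\<^sub>R f j) = 0" and "j \<in> I"
  shows "c j = 0"
proof (rule ccontr)
  assume "c j \<noteq> 0"
  have ne: "(\<lambda>j. \<bar>c j\<bar>) ` I \<noteq> {}" "finite ((\<lambda>j. \<bar>c j\<bar>) ` I)"
    using assms by auto
  then have "Max ((\<lambda>j. \<bar>c j\<bar>) ` I) \<in> (\<lambda>j. \<bar>c j\<bar>) ` I" by (intro Max_in)
  then obtain k where k: "k \<in> I" "Max ((\<lambda>j. \<bar>c j\<bar>) ` I) = \<bar>c k\<bar>" by blast
  have le: "\<bar>c i\<bar> \<le> \<bar>c k\<bar>" if "i \<in> I" for i
    using Max_ge[OF ne(2), of "\<bar>c i\<bar>"] that k by auto
  have pos: "\<bar>c k\<bar> > 0" using le[OF assms(5)] \<open>c j \<noteq> 0\<close> by simp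
  have "0 = l k (\<Sum>j\<in>I. c j *\<^sub>R f j)"
    using zero lin[OF k(1)] by (simp add: linear_0)
  also have "\<dots> = (\<Sum>j\<in>I. c j * l k (f j))"
    using lin[OF k(1)] by (simp add: linear_sum linear_scale)
  also have "\<dots> = (\<Sum>j\<in>I. c j * (l k (f j) - (if k = j then 1 else 0)) + (if k = j then c j else 0))"
    by (intro sum.cong) (auto simp: algebra_simps)
  also have "\<dots> = (\<Sum>j\<in>I. c j * (l k (f j) - (if k = j then 1 else 0))) + c k"
    using assms(1) k(1) by (simp add: sum.distrib)
  finally have "\<bar>c k\<bar> = \<bar>\<Sum>j\<in>I. c j * (l k (f j) - (if k = j then 1 else 0))\<bar>"
    by linarith
  also have "\<dots> \<le> (\<Sum>j\<in>I. \<bar>c j * (l k (f j) - (if k = j then 1 else 0))\<bar>)"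
    by (rule sum_abs)
  also have "\<dots> \<le> (\<Sum>j\<in>I. \<bar>c k\<bar> * \<bar>l k (f j) - (if k = j then 1 else 0)\<bar>)"
    unfolding abs_mult using le by (intro sum_mono mult_right_mono) auto
  also have "\<dots> < \<bar>c k\<bar>"
    using small[OF k(1)] pos by (simp flip: sum_distrib_left)
  finally show False by simp
qed

text \<open>The inequality of rank and nullity in the form needed below: kernel vectors and vectors with
  independent images are independent together.\<close>

lemma independent_Un_if_kernel:
  fixes L :: "'v::real_vector \<Rightarrow> 'w::real_vector"
  assumes F: "subspace F" "\<And>u w. u \<in> F \<Longrightarrow> w \<in> F \<Longrightarrow> L (u + w) = L u + L w"
    "\<And>u a. u \<in> F \<Longrightarrow> L (a *\<^sub>R u) = a *\<^sub>R L u"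
    and K: "K \<subseteq> F" "independent K" "finite K" "\<And>k. k \<in> K \<Longrightarrow> L k = 0"
    and I: "I \<subseteq> F" "finite I" "\<And>c i. (\<Sum>i\<in>I. c i *\<^sub>R L i) = 0 \<Longrightarrow> i \<in> I \<Longrightarrow> c i = 0"
  shows "independent (K \<union> I)" "K \<inter> I = {}"
proof -
  show disj: "K \<inter> I = {}"
  proof (rule ccontr)
    assume "K \<inter> I \<noteq> {}"
    then obtain i where i: "i \<in> K" "i \<in> I" by blast
    have "(\<Sum>j\<in>I. (if j = i then 1 else 0) *\<^sub>R L j) = L i"
      using i I(2) by (simp add: if_distrib[of "\<lambda>x. x *\<^sub>R _"] cong: if_cong)
    then show False using I(3)[of "\<lambda>j. if j = i then 1 else 0" i] K(4) i by simp
  qed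
  show "independent (K \<union> I)"
    unfolding dependent_finite[OF finite_UnI[OF K(3) I(2)]]
  proof clarify
    fix c v assume v: "v \<in> K \<union> I" "c v \<noteq> 0" and "(\<Sum>v\<in>K \<union> I. c v *\<^sub>R v) = 0"
    then have z: "(\<Sum>v\<in>K. c v *\<^sub>R v) + (\<Sum>v\<in>I. c v *\<^sub>R v) = 0"
      using disj K(3) I(2) by (simp add: sum.union_disjoint)
    have mem: "(\<Sum>v\<in>K. c v *\<^sub>R v) \<in> F" "(\<Sum>v\<in>I. c v *\<^sub>R v) \<in> F"
      using K I by (auto intro!: subspace_sum[OF F(1)] subspace_scale[OF F(1)])
    have "(\<Sum>v\<in>K. c v *\<^sub>R L v) + (\<Sum>v\<in>I. c v *\<^sub>R L v) = L ((\<Sum>v\<in>K. c v *\<^sub>R v) + (\<Sum>v\<in>I. c v *\<^sub>R v))"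
      unfolding F(2)[OF mem]
      using linear_on_sum[OF F K(3), of "\<lambda>v. v" c] linear_on_sum[OF F I(2), of "\<lambda>v. v" c]
        subsetD[OF K(1)] subsetD[OF I(1)] by simp
    also have "\<dots> = 0"
      using F(3)[OF subspace_0[OF F(1)], of 0] z by simp
    finally have "(\<Sum>v\<in>I. c v *\<^sub>R L v) = 0" using K(4) by simp
    then have cI: "c i = 0" if "i \<in> I" for i using I(3) that by blast
    then have "(\<Sum>v\<in>K. c v *\<^sub>R v) = 0" using z by simp
    then have "c k = 0" if "k \<in> K" for k
      using independentD[OF K(2,3) subset_refl _ that] by blast
    with cI v show False by blast
  qed
qed

text \<open>The vector space carries no topology, so continuity and differentiability of \<open>B\<close> are tested by linear
  functionals. If \<open>b\<close> were not in the range of \<open>B 0\<close>, then near \<open>t = 0\<close> the map \<open>B t\<close> would have rank at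
  least one more than \<open>B 0\<close>: the independent vectors \<open>B 0 i\<close>, for \<open>i\<close> in a basis of a complement of the
  kernel, and \<open>b\<close> are limits of \<open>B t i\<close> and of \<open>B t u / t\<close>.\<close>

lemma derivative_in_range_of_const_nullity:
  fixes B :: "real \<Rightarrow> 'v::real_vector \<Rightarrow> 'w::real_vector"
  assumes F: "subspace F" "F \<subseteq> span S" "finite S"
    and add: "\<And>t u w. u \<in> F \<Longrightarrow> w \<in> F \<Longrightarrow> B t (u + w) = B t u + B t w"
    and scale: "\<And>t u a. u \<in> F \<Longrightarrow> B t (a *\<^sub>R u) = a *\<^sub>R B t u"
    and cont: "\<And>l w. linear l \<Longrightarrow> w \<in> F \<Longrightarrow> isCont (\<lambda>t. l (B t w) :: real) 0"
    and u: "u \<in> F" "B 0 u = 0"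
    and deriv: "\<And>l. linear l \<Longrightarrow> ((\<lambda>t. l (B t u)) has_real_derivative l b) (at 0)"
    and dim: "\<forall>\<^sub>F t in nhds 0. dim {w\<in>F. B 0 w = 0} \<le> dim {w\<in>F. B t w = 0}"
  shows "b \<in> B 0 ` F"
proof (rule ccontr)
  assume b: "b \<notin> B 0 ` F"
  have B0: "B t 0 = 0" for t
    using scale[of 0 t 0] F(1) subspace_0 by auto
  obtain N where N: "N \<subseteq> {w\<in>F. B 0 w = 0}" "independent N" "{w\<in>F. B 0 w = 0} \<subseteq> span N"
      "card N = dim {w\<in>F. B 0 w = 0}"
    by (rule real_vector.basis_exists)
  obtain C where C: "N \<subseteq> C" "C \<subseteq> F" "independent C" "F \<subseteq> span C"
    using real_vector.maximal_independent_subset_extend[of N F] N by blast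
  have finC: "finite C"
    using real_vector.independent_span_bound[OF F(3) C(3)] C(2) F(2) by blast
  have finN: "finite N" using finC C(1) finite_subset by blast
  \<comment> \<open>The vector \<open>u\<close> doubles as the index of the extra vector \<open>b\<close>; it is not in \<open>C - N\<close>.\<close>
  define I where "I = insert u (C - N)"
  have uI: "u \<notin> C - N"
  proof
    assume "u \<in> C - N"
    moreover have "u \<in> span N" using u N by blast
    moreover have "span N \<subseteq> span (C - {u})" using C(1) \<open>u \<in> C - N\<close> by (intro span_mono) blast
    ultimately show False using C(3) unfolding dependent_def by blast
  qed
  have finI: "finite I" and IF: "I \<subseteq> F" using finC C u by (auto simp: I_def)
  have cardI: "card I = card C - card N + 1"
    using uI finC finN C(1) by (simp add: I_def card_Diff_subset)
  define H where "H i = (if i = u then b else B 0 i)" for i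
  have H0: "c i = 0" if z: "(\<Sum>i\<in>I. c i *\<^sub>R H i) = 0" and i: "i \<in> I" for c i
  proof -
    define w where "w = (\<Sum>i\<in>C - N. c i *\<^sub>R i)"
    have wF: "w \<in> F" unfolding w_def
      using C by (intro subspace_sum[OF F(1)] subspace_scale[OF F(1)]) auto
    have "(\<Sum>i\<in>C - N. c i *\<^sub>R H i) = (\<Sum>i\<in>C - N. c i *\<^sub>R B 0 i)"
      using uI by (intro sum.cong) (auto simp: H_def)
    also have "\<dots> = B 0 w"
      unfolding w_def using C finC
      by (intro linear_on_sum[OF F(1) add scale, symmetric]) auto
    finally have e: "c u *\<^sub>R b + B 0 w = 0"
      using z uI finC by (simp add: I_def H_def)
    have cu: "c u = 0"
    proof (rule ccontr)
      assume "c u \<noteq> 0"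
      have "B 0 w = - (c u *\<^sub>R b)" using e by (metis add.commute eq_neg_iff_add_eq_0)
      then have "b = (- 1 / c u) *\<^sub>R B 0 w" using \<open>c u \<noteq> 0\<close> by simp
      also have "\<dots> = B 0 ((- 1 / c u) *\<^sub>R w)" by (rule scale[OF wF, symmetric])
      finally show False using b subspace_scale[OF F(1) wF] by blast
    qed
    then have "B 0 w = 0" using e by simp
    then have "w \<in> span N" using wF N by blast
    then obtain d where d: "w = (\<Sum>i\<in>N. d i *\<^sub>R i)"
      unfolding span_finite[OF finN] by auto
    have "(\<Sum>i\<in>C. (if i \<in> N then - d i else c i) *\<^sub>R i) =
        (\<Sum>i\<in>C - N. (if i \<in> N then - d i else c i) *\<^sub>R i) + (\<Sum>i\<in>N. (if i \<in> N then - d i else c i) *\<^sub>R i)"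
      by (rule sum.subset_diff[OF C(1) finC])
    also have "\<dots> = w - w"
      unfolding w_def[symmetric] by (subst (2) d) (simp add: w_def sum_negf)
    finally have "(\<Sum>i\<in>C. (if i \<in> N then - d i else c i) *\<^sub>R i) = 0" by simp
    from independentD[OF C(3) finC subset_refl this]
    have "(if j \<in> N then - d j else c j) = 0" if "j \<in> C" for j using that by blast
    then show ?thesis using i cu unfolding I_def by fastforce
  qed
  have injH: "inj_on H I"
  proof (rule inj_onI, rule ccontr)
    fix i j assume ij: "i \<in> I" "j \<in> I" "H i = H j" "i \<noteq> j"
    have "(\<Sum>k\<in>I. ((if k = i then 1 else 0) - (if k = j then 1 else 0)) *\<^sub>R H k) = H i - H j"
      using ij finI by (simp add: scaleR_diff_left sum_subtractf if_distrib[of "\<lambda>x. x *\<^sub>R _"] cong: if_cong)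
    then show False
      using H0[of "\<lambda>k. (if k = i then 1 else 0) - (if k = j then 1 else 0)" i] ij by simp
  qed
  have indH: "independent (H ` I)"
    unfolding dependent_finite[OF finite_imageI[OF finI]]
  proof clarify
    fix c i assume "(\<Sum>h\<in>H ` I. c h *\<^sub>R h) = 0" "i \<in> I" "c (H i) \<noteq> 0"
    then show False
      using H0[of "\<lambda>i. c (H i)" i] by (simp add: sum.reindex[OF injH])
  qed
  \<comment> \<open>The functionals dual to the independent family \<open>H\<close>.\<close>
  have "\<exists>l. linear l \<and> (\<forall>j\<in>I. l (H j) = (if i = j then 1 else 0 :: real))" for i
  proof -
    obtain l where "linear l" "\<And>h. h \<in> H ` I \<Longrightarrow> l h = (if i = inv_into I H h then 1 else 0 :: real)"
      using linear_independent_extend[OF indH, of "\<lambda>h. if i = inv_into I H h then 1 else 0 :: real"] by auto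
    then show ?thesis using injH by (auto intro!: exI[of _ l])
  qed
  then obtain l where l: "\<And>i. linear (l i)" "\<And>i j. j \<in> I \<Longrightarrow> l i (H j) = (if i = j then 1 else 0 :: real)"
    by metis
  \<comment> \<open>The family that tends to \<open>H\<close> as \<open>t\<close> tends to 0.\<close>
  define f where "f t i = (if i = u then inverse t *\<^sub>R B t u else B t i)" for t i
  have lim: "((\<lambda>t. l i (f t j)) \<longlongrightarrow> l i (H j)) (at 0)" if "j \<in> I" for i j
  proof (cases "j = u")
    case True
    have "((\<lambda>t. l i (B t u) / t) \<longlongrightarrow> l i b) (at 0)"
      using deriv[OF l(1)[of i]] u(2) linear_0[OF l(1)[of i]] by (simp add: has_field_derivative_iff)
    then show ?thesis
      by (simp add: f_def H_def True linear_scale[OF l(1)] divide_inverse mult.commute)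
  next
    case False
    then show ?thesis
      using cont[OF l(1), of j] IF that by (auto simp: f_def H_def isCont_def)
  qed
  have "\<forall>\<^sub>F t in at 0. (\<Sum>j\<in>I. \<bar>l i (f t j) - (if i = j then 1 else 0)\<bar>) < 1" for i
  proof (rule order_tendstoD(2))
    show "((\<lambda>t. \<Sum>j\<in>I. \<bar>l i (f t j) - (if i = j then 1 else 0)\<bar>) \<longlongrightarrow>
        (\<Sum>j\<in>I. \<bar>l i (H j) - (if i = j then 1 else 0)\<bar>)) (at 0)"
      by (intro tendsto_sum tendsto_rabs tendsto_diff tendsto_const lim)
    show "(\<Sum>j\<in>I. \<bar>l i (H j) - (if i = j then 1 else 0)\<bar>) < 1"
      using l(2) by simp
  qed
  then have "\<forall>\<^sub>F t in at 0. \<forall>i\<in>I. (\<Sum>j\<in>I. \<bar>l i (f t j) - (if i = j then 1 else 0)\<bar>) < 1"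
    using finI by (simp add: eventually_ball_finite)
  moreover have "\<forall>\<^sub>F t in at 0. dim {w\<in>F. B 0 w = 0} \<le> dim {w\<in>F. B t w = 0}"
    using dim by (simp add: eventually_at_filter eventually_mono)
  moreover have "\<forall>\<^sub>F t in at (0::real). t \<noteq> 0"
    by (simp add: eventually_at_filter)
  ultimately have "\<forall>\<^sub>F t in at (0::real). t \<noteq> 0 \<and> dim {w\<in>F. B 0 w = 0} \<le> dim {w\<in>F. B t w = 0} \<and>
      (\<forall>i\<in>I. (\<Sum>j\<in>I. \<bar>l i (f t j) - (if i = j then 1 else 0)\<bar>) < 1)"
    by eventually_elim blast
  then obtain t where t: "t \<noteq> 0" "dim {w\<in>F. B 0 w = 0} \<le> dim {w\<in>F. B t w = 0}"
      "\<And>i. i \<in> I \<Longrightarrow> (\<Sum>j\<in>I. \<bar>l i (f t j) - (if i = j then 1 else 0)\<bar>) < 1"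
    using eventually_happens'[OF trivial_limit_at] by blast
  have indep: "c i = 0" if z: "(\<Sum>i\<in>I. c i *\<^sub>R B t i) = 0" and i: "i \<in> I" for c i
  proof -
    have "(\<Sum>i\<in>I. (if i = u then t * c i else c i) *\<^sub>R f t i) = (\<Sum>i\<in>I. c i *\<^sub>R B t i)"
      using t(1) by (intro sum.cong) (auto simp: f_def)
    from independent_near_biorthogonal[OF finI l(1) t(3) this[unfolded z] i]
    show ?thesis using t(1) by (simp split: if_splits)
  qed
  \<comment> \<open>A basis \<open>M\<close> of the kernel of \<open>B t\<close> and \<open>I\<close> are together more independent vectors than \<open>F\<close> admits.\<close>
  obtain M where M: "M \<subseteq> {w\<in>F. B t w = 0}" "independent M" "{w\<in>F. B t w = 0} \<subseteq> span M"
      "card M = dim {w\<in>F. B t w = 0}"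
    by (rule real_vector.basis_exists)
  have finM: "finite M"
    using real_vector.independent_span_bound[OF F(3) M(2)] M(1) F(2) by blast
  have MF: "M \<subseteq> F" and kills: "\<And>k. k \<in> M \<Longrightarrow> B t k = 0"
    using M(1) by auto
  have disj: "M \<inter> I = {}"
    by (rule independent_Un_if_kernel(2)[where F = F and L = "B t"])
      (fact F(1) add scale MF M(2) finM kills IF finI indep)+
  have "independent (M \<union> I)"
    by (rule independent_Un_if_kernel(1)[where F = F and L = "B t"])
      (fact F(1) add scale MF M(2) finM kills IF finI indep)+
  then have "card (M \<union> I) \<le> card C"
    using real_vector.independent_span_bound[OF finC, of "M \<union> I"] MF IF C(4) by auto
  moreover have "card (M \<union> I) = card M + card I"
    using finM finI disj by (rule card_Un_disjoint)
  moreover have "card N \<le> card C" using C(1) finC by (rule card_mono[rotated])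
  ultimately show False
    using cardI M(4) N(4) t(2) by simp
qed

section \<open>Smooth functions on a manifold\<close>

lemma chart_open:
  assumes "smooth_manifold A" "(U, \<phi>) \<in> A"
  shows "open U"
  using assms unfolding smooth_manifold_def by blast

lemma chart_homeomorphism:
  assumes "smooth_manifold A" "(U, \<phi>) \<in> A"
  shows "homeomorphism U (\<phi> ` U) \<phi> (inv_into U \<phi>)"
  using assms unfolding smooth_manifold_def by blast

lemma chart_inv:
  assumes "smooth_manifold A" "(U, \<phi>) \<in> A" "y \<in> U"
  shows "inv_into U \<phi> (\<phi> y) = y"
  using chart_homeomorphism[OF assms(1,2)] assms(3) unfolding homeomorphism_def by blast

lemma chart_image_open:
  assumes "smooth_manifold A" "(U, \<phi>) \<in> A" "open W"
  shows "open (\<phi> ` (U \<inter> W))"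
proof -
  have "openin (top_of_set U) (U \<inter> W)"
    using assms(3) by (simp add: openin_open_Int)
  then have "openin (top_of_set (\<phi> ` U)) (\<phi> ` (U \<inter> W))"
    using homeomorphism_imp_open_map chart_homeomorphism[OF assms(1,2)] by blast
  moreover have "open (\<phi> ` U)"
    using assms unfolding smooth_manifold_def by blast
  ultimately show ?thesis by (rule openin_open_trans)
qed

lemma chart_transition:
  assumes "smooth_manifold A" "(U, \<phi>) \<in> A" "(V, \<psi>) \<in> A"
  shows "smooth_on (\<phi> ` (U \<inter> V)) (\<psi> \<circ> inv_into U \<phi>)"
  using assms unfolding smooth_manifold_def by blast

lemma chart_at:
  assumes "smooth_manifold A"
  obtains U \<phi> where "(U, \<phi>) \<in> A" "x \<in> U"
proof -
  have "x \<in> (\<Union>(U, \<phi>)\<in>A. U)"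
    using assms unfolding smooth_manifold_def by simp
  then show ?thesis using that by auto
qed

context
  fixes A :: "('m::{t2_space,second_countable_topology}, 'e::real_inner) atlas"
  assumes M: "smooth_manifold A"
begin

lemma smooth_fun_on_subset: "smooth_fun_on A W f \<Longrightarrow> W' \<subseteq> W \<Longrightarrow> smooth_fun_on A W' f"
  unfolding smooth_fun_on_def by (blast intro: smooth_on_subset)

lemma smooth_fun_on_cong:
  assumes "open W" "\<And>y. y \<in> W \<Longrightarrow> f y = g y" "smooth_fun_on A W f"
  shows "smooth_fun_on A W g"
  unfolding smooth_fun_on_def
proof clarify
  fix U \<phi> assume c: "(U, \<phi>) \<in> A"
  show "smooth_on (\<phi> ` (U \<inter> W)) (g \<circ> inv_into U \<phi>)"
  proof (rule smooth_on_cong[OF chart_image_open[OF M c assms(1)], of "f \<circ> inv_into U \<phi>"])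
    show "smooth_on (\<phi> ` (U \<inter> W)) (f \<circ> inv_into U \<phi>)"
      using assms(3) c unfolding smooth_fun_on_def by blast
    show "(f \<circ> inv_into U \<phi>) z = (g \<circ> inv_into U \<phi>) z" if "z \<in> \<phi> ` (U \<inter> W)" for z
      using that assms(2) by (auto simp: chart_inv[OF M c])
  qed
qed

lemma smooth_fun_on_Un:
  assumes "open W" "open W'" "smooth_fun_on A W f" "smooth_fun_on A W' f"
  shows "smooth_fun_on A (W \<union> W') f"
  unfolding smooth_fun_on_def Int_Un_distrib image_Un
proof clarify
  fix U \<phi> assume c: "(U, \<phi>) \<in> A"
  show "smooth_on (\<phi> ` (U \<inter> W) \<union> \<phi> ` (U \<inter> W')) (f \<circ> inv_into U \<phi>)"
    using assms(3,4) c unfolding smooth_fun_on_def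
    by (intro smooth_on_Un chart_image_open[OF M c] assms(1,2)) auto
qed

lemma smooth_fun_on_const: "smooth_fun_on A W (\<lambda>y. c)"
  unfolding smooth_fun_on_def by (auto simp: comp_def smooth_on_const)

lemma smooth_fun_on_add:
  assumes "open W" "smooth_fun_on A W f" "smooth_fun_on A W g"
  shows "smooth_fun_on A W (\<lambda>y. f y + g y)"
  unfolding smooth_fun_on_def comp_def
proof clarify
  fix U \<phi> assume c: "(U, \<phi>) \<in> A"
  show "smooth_on (\<phi> ` (U \<inter> W)) (\<lambda>z. f (inv_into U \<phi> z) + g (inv_into U \<phi> z))"
    using assms(2,3) c unfolding smooth_fun_on_def comp_def
    by (intro smooth_on_add chart_image_open[OF M c assms(1)]) auto
qed

lemma smooth_fun_on_mult:
  assumes "open W" "smooth_fun_on A W f" "smooth_fun_on A W g"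
  shows "smooth_fun_on A W (\<lambda>y. f y * g y)"
  unfolding smooth_fun_on_def comp_def
proof clarify
  fix U \<phi> assume c: "(U, \<phi>) \<in> A"
  show "smooth_on (\<phi> ` (U \<inter> W)) (\<lambda>z. f (inv_into U \<phi> z) * g (inv_into U \<phi> z))"
    using assms(2,3) c unfolding smooth_fun_on_def comp_def
    by (intro smooth_on_bilinear[OF bounded_bilinear_mult] chart_image_open[OF M c assms(1)]) auto
qed

lemma smooth_fun_on_sum:
  assumes "open W" "finite I" "\<And>i. i \<in> I \<Longrightarrow> smooth_fun_on A W (f i)"
  shows "smooth_fun_on A W (\<lambda>y. \<Sum>i\<in>I. f i y)"
  using assms(2,3)
  by (induction I) (auto intro!: smooth_fun_on_const smooth_fun_on_add assms(1))

text \<open>Smoothness is local: \<open>W\<close> is covered by the open sets \<open>U \<inter> W\<close> and \<open>W - C\<close>, and \<open>f\<close> vanishes on the latter.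
  This is the reason why supports are required to lie in a closed set and not just in \<open>U\<close>.\<close>

lemma smooth_fun_on_extend_zero:
  assumes "open U" "closed C" "C \<subseteq> U" "open W" "smooth_fun_on A (U \<inter> W) f"
    and "\<And>y. y \<in> W \<Longrightarrow> y \<notin> C \<Longrightarrow> f y = 0"
  shows "smooth_fun_on A W f"
proof -
  have "smooth_fun_on A (W - C) f"
    by (rule smooth_fun_on_cong[OF open_Diff[OF assms(4,2)] _ smooth_fun_on_const[of _ 0]])
      (simp add: assms(6))
  then have "smooth_fun_on A ((U \<inter> W) \<union> (W - C)) f"
    by (rule smooth_fun_on_Un[OF open_Int[OF assms(1,4)] open_Diff[OF assms(4,2)] assms(5)])
  moreover have "(U \<inter> W) \<union> (W - C) = W" using assms(3) by blast
  ultimately show ?thesis by simp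
qed

text \<open>In a chart \<open>\<phi>\<close> the bump function is \<open>exp (- 1 / q)\<close> with \<open>q y = r\<^sup>2 - (norm (\<phi> y - p))\<^sup>2\<close>, cut off where
  \<open>q\<close> is not positive. It vanishes off the preimage of a closed ball, which is compact because the model
  space has finite dimension, hence closed because the manifold is Hausdorff.\<close>

lemma bump_function:
  assumes W: "open W" "x \<in> W"
  obtains \<rho> C where "smooth_fun A \<rho>" "\<rho> x = 1" "closed C" "C \<subseteq> W"
    "\<And>y. y \<notin> C \<Longrightarrow> \<rho> y = 0"
proof -
  obtain U \<phi> where c: "(U, \<phi>) \<in> A" and x: "x \<in> U" using chart_at[OF M] .
  define p where "p = \<phi> x"
  obtain r where r: "r > 0" "cball p r \<subseteq> \<phi> ` (U \<inter> W)"
    using chart_image_open[OF M c W(1)] W(2) x unfolding open_contains_cball p_def by blast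
  define C where "C = inv_into U \<phi> ` cball p r"
  obtain B :: "'e set" where "finite B" "span B = UNIV"
    using conjunct1[OF M[unfolded smooth_manifold_def]] by blast
  then have "compact (cball p r)" by (rule compact_cball_finite_span)
  moreover have "continuous_on (cball p r) (inv_into U \<phi>)"
    using chart_homeomorphism[OF M c] r(2) unfolding homeomorphism_def
    by (meson continuous_on_subset image_mono inf_le1 subset_trans)
  ultimately have "compact C" unfolding C_def by (rule compact_continuous_image[rotated])
  then have C: "closed C" by (rule compact_imp_closed)
  have CUW: "C \<subseteq> U \<inter> W"
  proof
    fix y assume "y \<in> C"
    then obtain z where z: "z \<in> \<phi> ` (U \<inter> W)" "y = inv_into U \<phi> z"
      using r(2) unfolding C_def by blast
    then obtain y' where "y' \<in> U \<inter> W" "z = \<phi> y'" by blast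
    then show "y \<in> U \<inter> W" using z(2) chart_inv[OF M c, of y'] by simp
  qed
  \<comment> \<open>Sums and products only, the operations under which smoothness is known to be preserved.\<close>
  define q where "q y = r\<^sup>2 + (- 1) * ((\<phi> y + (- p)) \<bullet> (\<phi> y + (- p)))" for y
  define f where "f y = (if y \<in> U then flat_exp 1 (q y) else 0)" for y
  have zero: "f y = 0" if "y \<notin> C" for y
  proof (cases "y \<in> U")
    case True
    have "\<phi> y \<notin> cball p r"
    proof
      assume "\<phi> y \<in> cball p r"
      then have "inv_into U \<phi> (\<phi> y) \<in> C" unfolding C_def by blast
      then show False using chart_inv[OF M c True] that by simp
    qed
    then have "r < norm (\<phi> y - p)" by (simp add: dist_norm norm_minus_commute)
    then have "r\<^sup>2 < (norm (\<phi> y - p))\<^sup>2" using r(1) by (simp add: power_strict_mono)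
    then have "q y \<le> 0" by (simp add: q_def power2_norm_eq_inner)
    then show ?thesis by (simp add: f_def flat_exp_def)
  qed (simp add: f_def)
  have fx: "f x > 0" using x r(1) by (simp add: f_def q_def p_def flat_exp_def)
  have "smooth_fun_on A U f"
    unfolding smooth_fun_on_def
  proof clarify
    fix V \<psi> assume v: "(V, \<psi>) \<in> A"
    let ?S = "\<psi> ` (V \<inter> U)"
    have o: "open ?S" by (rule chart_image_open[OF M v chart_open[OF M c]])
    have "smooth_on ?S (\<lambda>z. (\<phi> \<circ> inv_into V \<psi>) z + (- p))"
      by (intro smooth_on_add[OF o] chart_transition[OF M v c] smooth_on_const)
    note sm = this
    have "smooth_on ?S (\<lambda>z. r\<^sup>2 + (- 1) * (((\<phi> \<circ> inv_into V \<psi>) z + (- p)) \<bullet>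
        ((\<phi> \<circ> inv_into V \<psi>) z + (- p))))"
      by (rule smooth_on_add[OF o smooth_on_const smooth_on_bilinear[OF bounded_bilinear_mult o
            smooth_on_const smooth_on_bilinear[OF bounded_bilinear_inner o sm sm]]])
    then have "smooth_on ?S (\<lambda>z. flat_exp 1 (q (inv_into V \<psi> z)))"
      unfolding smooth_on_def q_def comp_def
      using Ck_on_chain[where F = flat_exp, OF flat_exp_has_derivative o] by blast
    then show "smooth_on ?S (f \<circ> inv_into V \<psi>)"
      by (rule smooth_on_cong[OF o, rotated]) (auto simp: f_def chart_inv[OF M v])
  qed
  then have "smooth_fun A f"
    using smooth_fun_on_extend_zero[OF chart_open[OF M c] C, of UNIV f] zero CUW by simp
  then have "smooth_fun A (\<lambda>y. inverse (f x) * f y)"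
    by (intro smooth_fun_on_mult smooth_fun_on_const open_UNIV)
  then show ?thesis
    using that[of "\<lambda>y. inverse (f x) * f y" C] C CUW zero fx by auto
qed

section \<open>Curves and their velocities\<close>

text \<open>Identifies \<open>velocity\<close>, which is defined by the total operator \<open>deriv\<close>, with an actual derivative.\<close>

lemma smooth_fun_along_curve_differentiable:
  assumes f: "smooth_fun A f" and \<gamma>: "smooth_curve A I \<gamma>" "t \<in> I"
  shows "((\<lambda>t. f (\<gamma> t)) has_real_derivative velocity A \<gamma> t f) (at t)"
proof -
  obtain U \<phi> where c: "(U, \<phi>) \<in> A" and x: "\<gamma> t \<in> U" using chart_at[OF M] .
  let ?J = "{s \<in> I. \<gamma> s \<in> U}"
  have "open I" "continuous_on I \<gamma>" and sm: "smooth_on ?J (\<phi> \<circ> \<gamma>)"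
    using \<gamma>(1) c unfolding smooth_curve_def by auto
  then have oJ: "open ?J"
    using continuous_open_preimage[of I \<gamma> U] chart_open[OF M c]
    by (auto simp: vimage_def Int_def)
  have tJ: "t \<in> ?J" using \<gamma>(2) x by simp
  have "(\<phi> \<circ> \<gamma>) differentiable (at t)"
    by (rule smooth_on_imp_differentiable[OF sm tJ])
  moreover have "(f \<circ> inv_into U \<phi>) differentiable (at ((\<phi> \<circ> \<gamma>) t))"
    using f c x unfolding smooth_fun_on_def
    by (intro smooth_on_imp_differentiable[of "\<phi> ` U"]) auto
  ultimately have "((f \<circ> inv_into U \<phi>) \<circ> (\<phi> \<circ> \<gamma>)) differentiable (at t)"
    by (rule differentiable_chain_at)
  then obtain d where "(((f \<circ> inv_into U \<phi>) \<circ> (\<phi> \<circ> \<gamma>)) has_derivative d) (at t)"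
    unfolding differentiable_def by blast
  then have "((\<lambda>t. f (\<gamma> t)) has_derivative d) (at t)"
    by (rule has_derivative_transform_within_open[OF _ oJ tJ]) (simp add: chart_inv[OF M c])
  then have "(\<lambda>t. f (\<gamma> t)) differentiable (at t)"
    unfolding differentiable_def by blast
  then show ?thesis
    using f by (simp add: velocity_def comp_def DERIV_deriv_iff_real_differentiable)
qed

lemma velocity_in_tangent_space:
  assumes \<gamma>: "smooth_curve A I \<gamma>" "t \<in> I"
  shows "velocity A \<gamma> t \<in> tangent_space A (\<gamma> t)"
proof -
  note D = smooth_fun_along_curve_differentiable[OF _ \<gamma>]
  have add: "velocity A \<gamma> t (\<lambda>y. f y + g y) = velocity A \<gamma> t f + velocity A \<gamma> t g"
    if "smooth_fun A f" "smooth_fun A g" for f g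
    using D[OF smooth_fun_on_add[OF open_UNIV that]] DERIV_add[OF D[OF that(1)] D[OF that(2)]]
    by (rule DERIV_unique)
  have mult: "velocity A \<gamma> t (\<lambda>y. f y * g y) = velocity A \<gamma> t f * g (\<gamma> t) + f (\<gamma> t) * velocity A \<gamma> t g"
    if "smooth_fun A f" "smooth_fun A g" for f g
    using DERIV_unique[OF D[OF smooth_fun_on_mult[OF open_UNIV that]]
        DERIV_mult[OF D[OF that(1)] D[OF that(2)]]] by (simp add: mult.commute)
  have const: "velocity A \<gamma> t (\<lambda>y. c) = 0" for c
    using D[OF smooth_fun_on_const] DERIV_const by (rule DERIV_unique)
  have scale: "velocity A \<gamma> t (\<lambda>y. c * f y) = c * velocity A \<gamma> t f" if "smooth_fun A f" for c f
    using mult[OF smooth_fun_on_const[of UNIV c] that] const by simp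
  show ?thesis
    unfolding tangent_space_def using add mult scale by (auto simp: velocity_def)
qed

end

section \<open>Sections of a vector bundle with a connection\<close>

locale bundle_connection =
  fixes A :: "('m::{t2_space,second_countable_topology}, 'e::real_inner) atlas"
    and r :: nat
    and E :: "'m \<Rightarrow> 'v::real_vector set"
    and T :: "('m, 'v) bundle_atlas"
    and D :: "('m, 'v) covariant_derivative"
  assumes manifold: "smooth_manifold A"
    and vbundle: "vector_bundle A r E T"
    and conn: "connection A r E T D"
begin

abbreviation smooth_sec :: "('m \<Rightarrow> 'v) \<Rightarrow> bool" where
  "smooth_sec \<equiv> smooth_section A r E T"

lemma fibre_subspace: "subspace (E y)"
  using conjunct1[OF vbundle[unfolded vector_bundle_def]] by blast

lemma
  assumes "(U, \<tau>) \<in> T"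
  shows triv_open: "open U"
    and triv_bij: "y \<in> U \<Longrightarrow> bij_betw (\<tau> y) (E y) {c. \<forall>i\<ge>r. c i = 0}"
    and triv_add: "y \<in> U \<Longrightarrow> u \<in> E y \<Longrightarrow> w \<in> E y \<Longrightarrow> \<tau> y (u + w) i = \<tau> y u i + \<tau> y w i"
    and triv_scale: "y \<in> U \<Longrightarrow> u \<in> E y \<Longrightarrow> \<tau> y (a *\<^sub>R u) i = a * \<tau> y u i"
proof -
  note triv = bspec[OF conjunct1[OF conjunct2[OF conjunct2[OF vbundle[unfolded vector_bundle_def]]]]
      assms, unfolded prod.case]
  show "open U" using triv by (rule conjunct1)
  note fib = bspec[OF conjunct2[OF triv]]
  show "bij_betw (\<tau> y) (E y) {c. \<forall>i\<ge>r. c i = 0}" if "y \<in> U"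
    using fib[OF that] by (rule conjunct1)
  show "\<tau> y (u + w) i = \<tau> y u i + \<tau> y w i" if "y \<in> U" "u \<in> E y" "w \<in> E y"
    using conjunct1[OF conjunct2[OF fib[OF that(1)]]] that(2,3) by blast
  show "\<tau> y (a *\<^sub>R u) i = a * \<tau> y u i" if "y \<in> U" "u \<in> E y"
    using conjunct2[OF conjunct2[OF fib[OF that(1)]]] that(2) by blast
qed

lemma triv_transition:
  assumes "(U, \<tau>) \<in> T" "(V, \<sigma>) \<in> T"
  obtains g where "\<And>i j. i < r \<Longrightarrow> j < r \<Longrightarrow> smooth_fun_on A (U \<inter> V) (g i j)"
    "\<And>y u i. y \<in> U \<Longrightarrow> y \<in> V \<Longrightarrow> u \<in> E y \<Longrightarrow> i < r \<Longrightarrow> \<sigma> y u i = (\<Sum>j<r. g i j y * \<tau> y u j)"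
proof -
  have "\<exists>g :: nat \<Rightarrow> nat \<Rightarrow> 'm \<Rightarrow> real.
        (\<forall>i<r. \<forall>j<r. smooth_fun_on A (U \<inter> V) (g i j)) \<and>
        (\<forall>x\<in>U \<inter> V. \<forall>u\<in>E x. \<forall>i<r. \<sigma> x u i = (\<Sum>j<r. g i j x * \<tau> x u j))"
    by (rule bspec[OF bspec[OF conjunct2[OF conjunct2[OF conjunct2[OF
              vbundle[unfolded vector_bundle_def]]]] assms(1), unfolded prod.case] assms(2),
          unfolded prod.case])
  then obtain g :: "nat \<Rightarrow> nat \<Rightarrow> 'm \<Rightarrow> real" where
    g: "\<forall>i<r. \<forall>j<r. smooth_fun_on A (U \<inter> V) (g i j)"
      "\<forall>x\<in>U \<inter> V. \<forall>u\<in>E x. \<forall>i<r. \<sigma> x u i = (\<Sum>j<r. g i j x * \<tau> x u j)"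
    by blast
  show ?thesis
    by (rule that[of g]) (use g in blast)+
qed

lemma triv_zero:
  assumes "(U, \<tau>) \<in> T" "y \<in> U"
  shows "\<tau> y 0 i = 0"
  using triv_scale[OF assms subspace_0[OF fibre_subspace], of 0] by simp

lemma triv_sum:
  assumes t: "(U, \<tau>) \<in> T" "y \<in> U" and s: "finite I" "\<And>i. i \<in> I \<Longrightarrow> s i \<in> E y"
  shows "\<tau> y (\<Sum>i\<in>I. c i *\<^sub>R s i) k = (\<Sum>i\<in>I. c i * \<tau> y (s i) k)"
  using linear_on_sum[OF fibre_subspace, where L = "\<lambda>u. \<tau> y u k" and g = s and c = c, of y I] s
    triv_add[OF t] triv_scale[OF t] by simp

lemma triv_inject:
  assumes "(U, \<tau>) \<in> T" "y \<in> U" "u \<in> E y" "w \<in> E y" "\<And>i. i < r \<Longrightarrow> \<tau> y u i = \<tau> y w i"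
  shows "u = w"
proof -
  have b: "bij_betw (\<tau> y) (E y) {c. \<forall>i\<ge>r. c i = 0}" by (rule triv_bij[OF assms(1,2)])
  have "\<tau> y u i = \<tau> y w i" for i
    using bij_betwE[OF b] assms(3-5) by (cases "i < r") auto
  then show ?thesis
    using bij_betw_imp_inj_on[OF b] assms(3,4) by (meson ext inj_onD)
qed

lemma smooth_section_in: "smooth_sec s \<Longrightarrow> s y \<in> E y"
  unfolding smooth_section_def by blast

lemma smooth_section_component:
  "smooth_sec s \<Longrightarrow> (U, \<tau>) \<in> T \<Longrightarrow> i < r \<Longrightarrow> smooth_fun_on A U (\<lambda>y. \<tau> y (s y) i)"
  unfolding smooth_section_def by blast

lemma smooth_section_add:
  assumes "smooth_sec s" "smooth_sec s'"
  shows "smooth_sec (\<lambda>y. s y + s' y)"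
  unfolding smooth_section_def
proof (intro conjI allI ballI, goal_cases)
  case (1 y)
  show ?case using assms by (intro subspace_add[OF fibre_subspace] smooth_section_in)
next
  case (2 Ut)
  obtain U \<tau> where Ut: "Ut = (U, \<tau>)" by fastforce
  with 2 have t: "(U, \<tau>) \<in> T" by simp
  have "smooth_fun_on A U (\<lambda>y. \<tau> y (s y + s' y) i)" if "i < r" for i
    by (rule smooth_fun_on_cong[OF manifold triv_open[OF t] _ smooth_fun_on_add[OF manifold triv_open[OF t]
          smooth_section_component[OF assms(1) t that] smooth_section_component[OF assms(2) t that]]])
      (simp add: triv_add[OF t] smooth_section_in assms)
  then show ?case unfolding Ut by simp
qed

lemma smooth_section_scale:
  assumes "smooth_fun A f" "smooth_sec s"
  shows "smooth_sec (\<lambda>y. f y *\<^sub>R s y)"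
  unfolding smooth_section_def
proof (intro conjI allI ballI, goal_cases)
  case (1 y)
  show ?case using assms by (intro subspace_scale[OF fibre_subspace] smooth_section_in)
next
  case (2 Ut)
  obtain U \<tau> where Ut: "Ut = (U, \<tau>)" by fastforce
  with 2 have t: "(U, \<tau>) \<in> T" by simp
  have "smooth_fun_on A U (\<lambda>y. \<tau> y (f y *\<^sub>R s y) i)" if "i < r" for i
    by (rule smooth_fun_on_cong[OF manifold triv_open[OF t] _ smooth_fun_on_mult[OF manifold triv_open[OF t]
          smooth_fun_on_subset[OF manifold assms(1) subset_UNIV] smooth_section_component[OF assms(2) t that]]])
      (simp add: triv_scale[OF t] smooth_section_in assms)
  then show ?case unfolding Ut by simp
qed

lemma smooth_section_zero: "smooth_sec (\<lambda>y. 0)"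
  unfolding smooth_section_def
proof (intro conjI allI ballI, goal_cases)
  case (1 y)
  show ?case by (rule subspace_0[OF fibre_subspace])
next
  case (2 Ut)
  obtain U \<tau> where Ut: "Ut = (U, \<tau>)" by fastforce
  with 2 have t: "(U, \<tau>) \<in> T" by simp
  have "smooth_fun_on A U (\<lambda>y. \<tau> y 0 i)" for i
    by (rule smooth_fun_on_cong[OF manifold triv_open[OF t] _ smooth_fun_on_const[OF manifold, of _ 0]])
      (simp add: triv_zero[OF t])
  then show ?case unfolding Ut by simp
qed

lemma
  assumes "smooth_End_section A r E T L"
  shows End_in: "u \<in> E y \<Longrightarrow> L y u \<in> E y"
    and End_add: "u \<in> E y \<Longrightarrow> w \<in> E y \<Longrightarrow> L y (u + w) = L y u + L y w"
    and End_scale: "u \<in> E y \<Longrightarrow> L y (a *\<^sub>R u) = a *\<^sub>R L y u"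
  using assms unfolding smooth_End_section_def endomorphisms_def by auto

lemma End_zero: "smooth_End_section A r E T L \<Longrightarrow> L y 0 = 0"
  using End_scale[OF _ subspace_0[OF fibre_subspace], of L y 0] by simp

lemma End_diff:
  assumes "smooth_End_section A r E T L" "u \<in> E y" "w \<in> E y"
  shows "L y (u - w) = L y u - L y w"
  using End_add[OF assms(1,2), of "(- 1) *\<^sub>R w"] End_scale[OF assms(1,3), of "- 1"]
    subspace_scale[OF fibre_subspace assms(3), of "- 1"] by simp

lemma End_sum:
  assumes "smooth_End_section A r E T L" "finite I" "\<And>i. i \<in> I \<Longrightarrow> s i \<in> E y"
  shows "L y (\<Sum>i\<in>I. c i *\<^sub>R s i) = (\<Sum>i\<in>I. c i *\<^sub>R L y (s i))"
  by (rule linear_on_sum[OF fibre_subspace[of y] _ _ assms(2,3)])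
    (simp_all add: End_add[OF assms(1)] End_scale[OF assms(1)])

lemma smooth_section_End:
  assumes L: "smooth_End_section A r E T L" and s: "smooth_sec s"
  shows "smooth_sec (\<lambda>y. L y (s y))"
  unfolding smooth_section_def
proof (intro conjI allI ballI, goal_cases)
  case (1 y)
  show ?case using s by (intro End_in[OF L] smooth_section_in)
next
  case (2 Ut)
  obtain U \<tau> where Ut: "Ut = (U, \<tau>)" by fastforce
  with 2 have t: "(U, \<tau>) \<in> T" by simp
  obtain a :: "nat \<Rightarrow> nat \<Rightarrow> 'm \<Rightarrow> real" where
    a: "\<And>i j. i < r \<Longrightarrow> j < r \<Longrightarrow> smooth_fun_on A U (a i j)"
      "\<And>y u i. y \<in> U \<Longrightarrow> u \<in> E y \<Longrightarrow> i < r \<Longrightarrow> \<tau> y (L y u) i = (\<Sum>j<r. a i j y * \<tau> y u j)"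
    using bspec[OF conjunct2[OF L[unfolded smooth_End_section_def]] t, unfolded prod.case] by blast
  have "smooth_fun_on A U (\<lambda>y. \<tau> y (L y (s y)) i)" if i: "i < r" for i
  proof (rule smooth_fun_on_cong[OF manifold triv_open[OF t]])
    show "smooth_fun_on A U (\<lambda>y. \<Sum>j<r. a i j y * \<tau> y (s y) j)"
      using a(1)[OF i] smooth_section_component[OF s t]
      by (intro smooth_fun_on_sum[OF manifold] smooth_fun_on_mult[OF manifold] triv_open[OF t]) auto
    show "(\<Sum>j<r. a i j y * \<tau> y (s y) j) = \<tau> y (L y (s y)) i" if "y \<in> U" for y
      using a(2)[OF that smooth_section_in[OF s] i] by simp
  qed
  then show ?case unfolding Ut by simp
qed

lemma smooth_End_add_scale:
  assumes L: "smooth_End_section A r E T L" and L': "smooth_End_section A r E T L'"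
  shows "smooth_End_section A r E T (\<lambda>y u. L y u + c *\<^sub>R L' y u)"
  unfolding smooth_End_section_def
proof (intro conjI allI ballI, goal_cases)
  case (1 y)
  show ?case
    unfolding endomorphisms_def
    by (auto simp: End_add[OF L] End_add[OF L'] End_scale[OF L] End_scale[OF L'] scaleR_add_right
        intro!: subspace_add[OF fibre_subspace] subspace_scale[OF fibre_subspace] End_in[OF L] End_in[OF L'])
next
  case (2 Ut)
  obtain U \<tau> where Ut: "Ut = (U, \<tau>)" by fastforce
  with 2 have t: "(U, \<tau>) \<in> T" by simp
  obtain a :: "nat \<Rightarrow> nat \<Rightarrow> 'm \<Rightarrow> real" where
    a: "\<And>i j. i < r \<Longrightarrow> j < r \<Longrightarrow> smooth_fun_on A U (a i j)"
      "\<And>y u i. y \<in> U \<Longrightarrow> u \<in> E y \<Longrightarrow> i < r \<Longrightarrow> \<tau> y (L y u) i = (\<Sum>j<r. a i j y * \<tau> y u j)"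
    using bspec[OF conjunct2[OF L[unfolded smooth_End_section_def]] t, unfolded prod.case] by blast
  obtain b :: "nat \<Rightarrow> nat \<Rightarrow> 'm \<Rightarrow> real" where
    b: "\<And>i j. i < r \<Longrightarrow> j < r \<Longrightarrow> smooth_fun_on A U (b i j)"
      "\<And>y u i. y \<in> U \<Longrightarrow> u \<in> E y \<Longrightarrow> i < r \<Longrightarrow> \<tau> y (L' y u) i = (\<Sum>j<r. b i j y * \<tau> y u j)"
    using bspec[OF conjunct2[OF L'[unfolded smooth_End_section_def]] t, unfolded prod.case] by blast
  have "smooth_fun_on A U (\<lambda>y. a i j y + c * b i j y)" if "i < r" "j < r" for i j
    using a(1)[OF that] b(1)[OF that]
    by (intro smooth_fun_on_add[OF manifold] smooth_fun_on_mult[OF manifold]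
        smooth_fun_on_const[OF manifold] triv_open[OF t])
  moreover have "\<tau> y (L y u + c *\<^sub>R L' y u) i = (\<Sum>j<r. (a i j y + c * b i j y) * \<tau> y u j)"
    if "y \<in> U" "u \<in> E y" "i < r" for y u i
    using that a(2) b(2) End_in[OF L] End_in[OF L'] subspace_scale[OF fibre_subspace]
    by (simp add: triv_add[OF t] triv_scale[OF t] distrib_right sum.distrib sum_distrib_left mult.assoc)
  ultimately show ?case
    unfolding Ut by (auto intro!: exI[of _ "\<lambda>i j y. a i j y + c * b i j y"])
qed

subsection \<open>The covariant derivative\<close>

lemma
  assumes "v \<in> tangent_space A x" "smooth_sec s"
  shows D_add: "smooth_sec s' \<Longrightarrow> D x v (\<lambda>y. s y + s' y) = D x v s + D x v s'"
    and D_Leibniz: "smooth_fun A f \<Longrightarrow> D x v (\<lambda>y. f y *\<^sub>R s y) = v f *\<^sub>R s x + f x *\<^sub>R D x v s"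
    and D_in: "D x v s \<in> E x"
  using conn assms unfolding connection_def by blast+

text \<open>The Leibniz rule for combinations of sections. Sections with constant coefficients
  and expansions in a frame are instances.\<close>

lemma D_sum:
  assumes v: "v \<in> tangent_space A x" and "finite I"
    and "\<And>i. i \<in> I \<Longrightarrow> smooth_fun A (f i)" "\<And>i. i \<in> I \<Longrightarrow> smooth_sec (s i)"
  shows "smooth_sec (\<lambda>y. \<Sum>i\<in>I. f i y *\<^sub>R s i y)"
    and "D x v (\<lambda>y. \<Sum>i\<in>I. f i y *\<^sub>R s i y) = (\<Sum>i\<in>I. v (f i) *\<^sub>R s i x + f i x *\<^sub>R D x v (s i))"
proof -
  have "smooth_sec (\<lambda>y. \<Sum>i\<in>I. f i y *\<^sub>R s i y) \<and>
    D x v (\<lambda>y. \<Sum>i\<in>I. f i y *\<^sub>R s i y) = (\<Sum>i\<in>I. v (f i) *\<^sub>R s i x + f i x *\<^sub>R D x v (s i))"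
    using assms(2-4)
  proof (induction I)
    case empty
    show ?case
      using smooth_section_zero
        D_Leibniz[OF v smooth_section_zero smooth_fun_on_const[OF manifold, of _ 0]] by simp
  next
    case (insert i I)
    have i: "smooth_sec (\<lambda>y. f i y *\<^sub>R s i y)"
      using insert.prems by (intro smooth_section_scale) auto
    show ?case
      using insert D_add[OF v i] smooth_section_add[OF i] D_Leibniz[OF v, of "s i" "f i"] by simp
  qed
  then show "smooth_sec (\<lambda>y. \<Sum>i\<in>I. f i y *\<^sub>R s i y)"
    and "D x v (\<lambda>y. \<Sum>i\<in>I. f i y *\<^sub>R s i y) = (\<Sum>i\<in>I. v (f i) *\<^sub>R s i x + f i x *\<^sub>R D x v (s i))"
    by auto
qed

text \<open>The value of \<open>\<nabla>\<^sub>v L\<close> on \<open>s\<close>, before it is known to depend on \<open>s x\<close> alone.\<close>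

definition D_commutator where
  "D_commutator x v L s = D x v (\<lambda>y. L y (s y)) - L x (D x v s)"

lemma D_commutator_sum:
  assumes v: "v \<in> tangent_space A x" and L: "smooth_End_section A r E T L" and I: "finite I"
    and f: "\<And>i. i \<in> I \<Longrightarrow> smooth_fun A (f i)" and s: "\<And>i. i \<in> I \<Longrightarrow> smooth_sec (s i)"
  shows "D_commutator x v L (\<lambda>y. \<Sum>i\<in>I. f i y *\<^sub>R s i y) = (\<Sum>i\<in>I. f i x *\<^sub>R D_commutator x v L (s i))"
proof -
  have "(\<lambda>y. L y (\<Sum>i\<in>I. f i y *\<^sub>R s i y)) = (\<lambda>y. \<Sum>i\<in>I. f i y *\<^sub>R L y (s i y))"
    using smooth_section_in[OF s]
    by (intro ext End_sum[OF L I]) auto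
  then have "D x v (\<lambda>y. L y (\<Sum>i\<in>I. f i y *\<^sub>R s i y)) =
      (\<Sum>i\<in>I. v (f i) *\<^sub>R L x (s i x) + f i x *\<^sub>R D x v (\<lambda>y. L y (s i y)))"
    using D_sum(2)[OF v I f smooth_section_End[OF L s]] by simp
  moreover have "L x (D x v (\<lambda>y. \<Sum>i\<in>I. f i y *\<^sub>R s i y)) =
      (\<Sum>i\<in>I. v (f i) *\<^sub>R L x (s i x) + f i x *\<^sub>R L x (D x v (s i)))"
  proof -
    have mem: "(\<Sum>i\<in>I. v (f i) *\<^sub>R s i x) \<in> E x" "(\<Sum>i\<in>I. f i x *\<^sub>R D x v (s i)) \<in> E x"
      using smooth_section_in[OF s] D_in[OF v s]
      by (intro subspace_sum[OF fibre_subspace] subspace_scale[OF fibre_subspace]; simp)+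
    have "D x v (\<lambda>y. \<Sum>i\<in>I. f i y *\<^sub>R s i y) =
        (\<Sum>i\<in>I. v (f i) *\<^sub>R s i x) + (\<Sum>i\<in>I. f i x *\<^sub>R D x v (s i))"
      unfolding sum.distrib[symmetric] by (rule D_sum(2)[OF v I f s])
    then show ?thesis
      using smooth_section_in[OF s] D_in[OF v s] mem
      by (simp add: End_add[OF L] sum.distrib
          End_sum[OF L I])
  qed
  ultimately show ?thesis
    unfolding D_commutator_def by (simp add: sum_subtractf[symmetric] scaleR_diff_right)
qed

end

section \<open>A frame of global sections\<close>

text \<open>A trivialisation at \<open>x\<close> with a bump function at \<open>x\<close> supported in it. Products with \<open>\<rho>\<close> turn functions
  and sections over \<open>U\<close> into global ones, regardless of the junk values outside \<open>U\<close>.\<close>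

locale bundle_frame = bundle_connection A r E T D
  for A :: "('m::{t2_space,second_countable_topology}, 'e::real_inner) atlas"
    and r :: nat
    and E :: "'m \<Rightarrow> 'v::real_vector set"
    and T :: "('m, 'v) bundle_atlas"
    and D :: "('m, 'v) covariant_derivative" +
  fixes x :: 'm and U :: "'m set" and \<tau> :: "'m \<Rightarrow> 'v \<Rightarrow> nat \<Rightarrow> real"
    and \<rho> :: "'m \<Rightarrow> real" and C :: "'m set"
  assumes triv: "(U, \<tau>) \<in> T" and xU: "x \<in> U"
    and bump: "smooth_fun A \<rho>" "\<rho> x = 1" "closed C" "C \<subseteq> U" "\<And>y. y \<notin> C \<Longrightarrow> \<rho> y = 0"

lemma (in bundle_connection) bundle_frame_exists:
  obtains U \<tau> \<rho> C where "bundle_frame A r E T D x U \<tau> \<rho> C"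
proof -
  have "x \<in> (\<Union>(U, \<tau>)\<in>T. U)"
    using conjunct1[OF conjunct2[OF vbundle[unfolded vector_bundle_def]]] by simp
  then obtain U \<tau> where t: "(U, \<tau>) \<in> T" "x \<in> U" by auto
  obtain \<rho> C where "smooth_fun A \<rho>" "\<rho> x = 1" "closed C" "C \<subseteq> U" "\<And>y. y \<notin> C \<Longrightarrow> \<rho> y = 0"
    by (rule bump_function[OF manifold triv_open[OF t(1)] t(2)]) (rule that)
  then have "bundle_frame A r E T D x U \<tau> \<rho> C"
    using t by unfold_locales
  then show ?thesis by (rule that)
qed

context bundle_frame
begin

lemma \<rho>_zero: "y \<notin> U \<Longrightarrow> \<rho> y = 0"
  using bump(4,5) by blast

lemma smooth_fun_cut:
  assumes "smooth_fun_on A U f"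
  shows "smooth_fun A (\<lambda>y. \<rho> y * f y)"
proof (rule smooth_fun_on_extend_zero[OF manifold triv_open[OF triv] bump(3,4) open_UNIV])
  show "smooth_fun_on A (U \<inter> UNIV) (\<lambda>y. \<rho> y * f y)"
    using smooth_fun_on_mult[OF manifold triv_open[OF triv]
        smooth_fun_on_subset[OF manifold bump(1) subset_UNIV] assms] by simp
qed (simp add: bump(5))

definition frame :: "nat \<Rightarrow> 'm \<Rightarrow> 'v" where
  "frame i y = inv_into (E y) (\<tau> y) (\<lambda>k. if k = i then 1 else 0)"

lemma
  assumes "y \<in> U" "i < r"
  shows frame_in: "frame i y \<in> E y"
    and triv_frame: "\<tau> y (frame i y) k = (if k = i then 1 else 0)"
proof -
  have b: "\<tau> y ` E y = {c. \<forall>i\<ge>r. c i = 0}"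
    using triv_bij[OF triv assms(1)] by (rule bij_betw_imp_surj_on)
  have "(\<lambda>k. if k = i then 1 else 0) \<in> \<tau> y ` E y"
    unfolding b using assms(2) by auto
  then show "frame i y \<in> E y" "\<tau> y (frame i y) k = (if k = i then 1 else 0)"
    unfolding frame_def by (rule inv_into_into, simp add: f_inv_into_f)
qed

lemma triv_frame_sum:
  assumes "y \<in> U" "k < r"
  shows "\<tau> y (\<Sum>i<r. c i *\<^sub>R frame i y) k = c k"
proof -
  have "\<tau> y (\<Sum>i<r. c i *\<^sub>R frame i y) k = (\<Sum>i<r. c i * \<tau> y (frame i y) k)"
    by (rule triv_sum[OF triv assms(1)]) (auto intro: frame_in[OF assms(1)])
  also have "\<dots> = (\<Sum>i<r. if k = i then c i else 0)"
    by (intro sum.cong) (auto simp: triv_frame[OF assms(1)])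
  finally show ?thesis using assms(2) by simp
qed

lemma frame_sum_in: "y \<in> U \<Longrightarrow> (\<Sum>i<r. c i *\<^sub>R frame i y) \<in> E y"
  by (intro subspace_sum[OF fibre_subspace] subspace_scale[OF fibre_subspace] frame_in) auto

lemma frame_expansion:
  assumes "y \<in> U" "u \<in> E y"
  shows "(\<Sum>i<r. \<tau> y u i *\<^sub>R frame i y) = u"
  using assms by (intro triv_inject[OF triv assms(1)] frame_sum_in triv_frame_sum) auto

lemma fibre_subset_span: "E x \<subseteq> span ((\<lambda>i. frame i x) ` {..<r})"
proof
  fix u assume "u \<in> E x"
  then have "u = (\<Sum>i<r. \<tau> x u i *\<^sub>R frame i x)"
    by (simp add: frame_expansion[OF xU])
  also have "\<dots> \<in> span ((\<lambda>i. frame i x) ` {..<r})"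
    by (intro span_sum span_scale span_base) auto
  finally show "u \<in> span ((\<lambda>i. frame i x) ` {..<r})" .
qed

text \<open>Global sections that form a basis of the fibre wherever \<open>\<rho>\<close> does not vanish.\<close>

definition global_frame :: "nat \<Rightarrow> 'm \<Rightarrow> 'v" where
  "global_frame i y = \<rho> y *\<^sub>R frame i y"

lemma global_frame_at: "global_frame i x = frame i x"
  by (simp add: global_frame_def bump(2))

lemma smooth_global_frame:
  assumes i: "i < r"
  shows "smooth_sec (global_frame i)"
  unfolding smooth_section_def
proof (intro conjI allI ballI, goal_cases)
  case (1 y)
  show ?case
    unfolding global_frame_def using i \<rho>_zero[of y]
    by (cases "y \<in> U") (auto intro!: subspace_scale[OF fibre_subspace] frame_in subspace_0[OF fibre_subspace])
next
  case (2 Vt)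
  obtain V \<sigma> where Vt: "Vt = (V, \<sigma>)" by fastforce
  with 2 have t: "(V, \<sigma>) \<in> T" by simp
  obtain g where g: "\<And>k j. k < r \<Longrightarrow> j < r \<Longrightarrow> smooth_fun_on A (U \<inter> V) (g k j)"
    "\<And>y u k. y \<in> U \<Longrightarrow> y \<in> V \<Longrightarrow> u \<in> E y \<Longrightarrow> k < r \<Longrightarrow> \<sigma> y u k = (\<Sum>j<r. g k j y * \<tau> y u j)"
    by (rule triv_transition[OF triv t]) (rule that)
  have "smooth_fun_on A V (\<lambda>y. \<sigma> y (global_frame i y) k)" if k: "k < r" for k
  proof (rule smooth_fun_on_extend_zero[OF manifold triv_open[OF triv] bump(3,4) triv_open[OF t]])
    have o: "open (U \<inter> V)" by (intro open_Int triv_open[OF triv] triv_open[OF t])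
    show "smooth_fun_on A (U \<inter> V) (\<lambda>y. \<sigma> y (global_frame i y) k)"
    proof (rule smooth_fun_on_cong[OF manifold o])
      show "smooth_fun_on A (U \<inter> V) (\<lambda>y. \<rho> y * g k i y)"
        by (rule smooth_fun_on_mult[OF manifold o smooth_fun_on_subset[OF manifold bump(1) subset_UNIV]
              g(1)[OF k i]])
      show "\<rho> y * g k i y = \<sigma> y (global_frame i y) k" if y: "y \<in> U \<inter> V" for y
      proof -
        have "\<sigma> y (frame i y) k = g k i y"
          using y i g(2)[OF _ _ frame_in[OF _ i] k, of y]
          by (simp add: triv_frame if_distrib cong: if_cong)
        then show ?thesis
          using y i frame_in[OF _ i, of y] triv_scale[OF t] by (simp add: global_frame_def)
      qed
    qed
    show "\<sigma> y (global_frame i y) k = 0" if "y \<in> V" "y \<notin> C" for y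
      using that bump(5) triv_zero[OF t] by (simp add: global_frame_def)
  qed
  then show ?case unfolding Vt by simp
qed

text \<open>A section with value \<open>u\<close> at \<open>x\<close>, constant in the trivialisation up to the factor \<open>\<rho>\<close>.\<close>

definition const_section :: "'v \<Rightarrow> 'm \<Rightarrow> 'v" where
  "const_section u y = (\<Sum>i<r. \<tau> x u i *\<^sub>R global_frame i y)"

lemma const_section_eq: "const_section u y = \<rho> y *\<^sub>R (\<Sum>i<r. \<tau> x u i *\<^sub>R frame i y)"
  by (simp add: const_section_def global_frame_def scaleR_sum_right mult.commute)

lemma smooth_const_section:
  assumes "v \<in> tangent_space A x"
  shows "smooth_sec (const_section u)"
  unfolding const_section_def
  using D_sum(1)[OF assms finite_lessThan smooth_fun_on_const[OF manifold] smooth_global_frame] by simp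

lemma const_section_at: "u \<in> E x \<Longrightarrow> const_section u x = u"
  by (simp add: const_section_eq bump(2) frame_expansion[OF xU])

text \<open>One factor \<open>\<rho>\<close> makes the components into global functions and the other one makes the frame
  into global sections.\<close>

lemma section_expansion:
  assumes "smooth_sec s"
  shows "(\<rho> y * \<rho> y) *\<^sub>R s y = (\<Sum>i<r. (\<rho> y * \<tau> y (s y) i) *\<^sub>R global_frame i y)"
proof (cases "y \<in> U")
  case True
  have "(\<rho> y * \<rho> y) *\<^sub>R s y = (\<rho> y * \<rho> y) *\<^sub>R (\<Sum>i<r. \<tau> y (s y) i *\<^sub>R frame i y)"
    by (simp add: frame_expansion[OF True smooth_section_in[OF assms]])
  then show ?thesis
    by (simp add: global_frame_def scaleR_sum_right ac_simps)
qed (simp add: \<rho>_zero)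

lemma smooth_cut_component:
  assumes "smooth_sec s" "i < r"
  shows "smooth_fun A (\<lambda>y. \<rho> y * \<tau> y (s y) i)"
  by (rule smooth_fun_cut[OF smooth_section_component[OF assms(1) triv assms(2)]])

text \<open>Both sides are linear over smooth functions, and \<open>\<rho>\<^sup>2 s\<close>, which is as good as \<open>s\<close> because \<open>\<rho> x = 1\<close>, is a
  combination of the global frame.\<close>

lemma D_commutator_tensorial:
  assumes v: "v \<in> tangent_space A x" and L: "smooth_End_section A r E T L" and s: "smooth_sec s"
  shows "D_commutator x v L s = (\<Sum>i<r. \<tau> x (s x) i *\<^sub>R D_commutator x v L (global_frame i))"
proof -
  have "D_commutator x v L (\<lambda>y. \<Sum>i\<in>{0::nat}. (\<rho> y * \<rho> y) *\<^sub>R s y) =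
      (\<Sum>i\<in>{0::nat}. (\<rho> x * \<rho> x) *\<^sub>R D_commutator x v L s)"
    by (rule D_commutator_sum[OF v L])
      (auto intro: s smooth_fun_on_mult[OF manifold open_UNIV bump(1,1)])
  then have "D_commutator x v L s = D_commutator x v L (\<lambda>y. (\<rho> y * \<rho> y) *\<^sub>R s y)"
    by (simp add: bump(2))
  also have "\<dots> = D_commutator x v L (\<lambda>y. \<Sum>i<r. (\<rho> y * \<tau> y (s y) i) *\<^sub>R global_frame i y)"
    by (simp add: section_expansion[OF s])
  also have "\<dots> = (\<Sum>i<r. (\<rho> x * \<tau> x (s x) i) *\<^sub>R D_commutator x v L (global_frame i))"
    by (rule D_commutator_sum[OF v L]) (auto intro: smooth_cut_component[OF s] smooth_global_frame)
  finally show ?thesis by (simp add: bump(2))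
qed

text \<open>The definite description in the definition of the induced connection is justified by tensoriality, and
  any section with the prescribed value computes it.\<close>

lemma nabla_End_eq:
  assumes v: "v \<in> tangent_space A x" and L: "smooth_End_section A r E T L" and s: "smooth_sec s"
  shows "nabla_End A r E T D x v L (s x) = D_commutator x v L s"
  unfolding nabla_End_def D_commutator_def[symmetric]
proof (rule the_equality)
  show "\<forall>s'. smooth_sec s' \<longrightarrow> s' x = s x \<longrightarrow> D_commutator x v L s = D_commutator x v L s'"
    using D_commutator_tensorial[OF v L] s by simp
  show "w = D_commutator x v L s"
    if "\<forall>s'. smooth_sec s' \<longrightarrow> s' x = s x \<longrightarrow> w = D_commutator x v L s'" for w
    using that s by blast
qed

text \<open>At a zero of \<open>s\<close> the connection terms of the Leibniz rule drop out, so every connection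
  differentiates \<open>s\<close> componentwise there.\<close>

lemma D_of_section_vanishing_at:
  assumes v: "v \<in> tangent_space A x" and s: "smooth_sec s" "s x = 0"
  shows "D x v s = (\<Sum>i<r. v (\<lambda>y. \<rho> y * \<tau> y (s y) i) *\<^sub>R frame i x)"
proof -
  have "D x v s = D x v (\<lambda>y. (\<rho> y * \<rho> y) *\<^sub>R s y)"
    using D_Leibniz[OF v s(1) smooth_fun_on_mult[OF manifold open_UNIV bump(1,1)]]
    by (simp add: s(2) bump(2))
  also have "\<dots> = D x v (\<lambda>y. \<Sum>i<r. (\<rho> y * \<tau> y (s y) i) *\<^sub>R global_frame i y)"
    by (simp add: section_expansion[OF s(1)])
  also have "\<dots> = (\<Sum>i<r. v (\<lambda>y. \<rho> y * \<tau> y (s y) i) *\<^sub>R global_frame i x +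
      (\<rho> x * \<tau> x (s x) i) *\<^sub>R D x v (global_frame i))"
    by (rule D_sum(2)[OF v]) (auto intro: smooth_cut_component[OF s(1)] smooth_global_frame)
  finally show ?thesis
    by (simp add: s(2) triv_zero[OF triv xU] global_frame_at)
qed

end

section \<open>Constant rank along a curve\<close>

text \<open>The maps \<open>B t\<close> on the fibre over \<open>x\<close> represent \<open>P\<close> at \<open>\<gamma> t\<close> in the trivialisation, multiplied by the
  square of \<open>\<rho> (\<gamma> t)\<close>. This factor makes the entries global smooth functions and changes neither kernels near \<open>0\<close>
  nor the derivative at a kernel vector.\<close>

lemma (in bundle_frame) nabla_maps_kernel_into_range:
  assumes P: "smooth_End_section A r E T P"
    and \<gamma>: "smooth_curve A I \<gamma>" "0 \<in> I" "\<gamma> 0 = x"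
    and nullity: "\<forall>\<^sub>F t in nhds 0. dim {w \<in> E (\<gamma> t). P (\<gamma> t) w = 0} = d"
    and u: "u \<in> E x" "P x u = 0"
  shows "nabla_End A r E T D x (velocity A \<gamma> 0) P u \<in> P x ` E x"
proof -
  define v where "v = velocity A \<gamma> 0"
  have v: "v \<in> tangent_space A x"
    using velocity_in_tangent_space[OF manifold \<gamma>(1,2)] by (simp add: v_def \<gamma>(3))
  have deriv: "((\<lambda>t. f (\<gamma> t)) has_real_derivative v f) (at 0)" if "smooth_fun A f" for f
    unfolding v_def by (rule smooth_fun_along_curve_differentiable[OF manifold that \<gamma>(1,2)])
  note const = smooth_const_section[OF v]
  note Pconst = smooth_section_End[OF P const]
  define h where "h w i y = \<rho> y * \<tau> y (P y (const_section w y)) i" for w i y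
  have h: "smooth_fun A (h w i)" if "i < r" for w i
    unfolding h_def by (rule smooth_cut_component[OF Pconst that])
  define B where "B t w = (\<Sum>i<r. h w i (\<gamma> t) *\<^sub>R frame i x)" for t w
  have h_add: "h (w + w') i y = h w i y + h w' i y" if "w \<in> E x" "w' \<in> E x" for w w' i y
  proof (cases "y \<in> U")
    case True
    have "const_section (w + w') y = const_section w y + const_section w' y"
      using that by (simp add: const_section_def triv_add[OF triv xU] scaleR_add_left sum.distrib)
    then show ?thesis
      using smooth_section_in[OF const] smooth_section_in[OF Pconst]
      by (simp add: h_def End_add[OF P] triv_add[OF triv True] algebra_simps)
  qed (simp add: h_def \<rho>_zero)
  have h_scale: "h (a *\<^sub>R w) i y = a * h w i y" if "w \<in> E x" for a w i y
  proof (cases "y \<in> U")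
    case True
    have "const_section (a *\<^sub>R w) y = a *\<^sub>R const_section w y"
      using that by (simp add: const_section_def triv_scale[OF triv xU] scaleR_sum_right)
    then show ?thesis
      using smooth_section_in[OF const] smooth_section_in[OF Pconst]
      by (simp add: h_def End_scale[OF P] triv_scale[OF triv True] algebra_simps)
  qed (simp add: h_def \<rho>_zero)
  have B0: "B 0 w = P x w" if "w \<in> E x" for w
    using that by (simp add: B_def h_def \<gamma>(3) bump(2) const_section_at frame_expansion[OF xU] End_in[OF P])
  define b where "b = D x v (\<lambda>y. P y (const_section u y))"
  have b: "b = (\<Sum>i<r. v (h u i) *\<^sub>R frame i x)"
    unfolding b_def h_def
    by (rule D_of_section_vanishing_at[OF v Pconst]) (simp add: const_section_at u)
  have ker: "dim {w \<in> E (\<gamma> t). P (\<gamma> t) w = 0} \<le> dim {w \<in> E x. B t w = 0}" if \<rho>: "\<rho> (\<gamma> t) \<noteq> 0" for t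
  proof -
    let ?y = "\<gamma> t"
    have yU: "?y \<in> U" using \<rho>_zero \<rho> by blast
    \<comment> \<open>Transport from the fibre over \<open>\<gamma> t\<close> to the one over \<open>x\<close>; it takes \<open>Ker P\<close> into \<open>Ker (B t)\<close>.\<close>
    define f where "f w = (\<Sum>i<r. \<tau> ?y w i *\<^sub>R frame i x)" for w
    have f_in: "f w \<in> E x" for w
      unfolding f_def by (rule frame_sum_in[OF xU])
    have f_triv: "\<tau> x (f w) i = \<tau> ?y w i" if "i < r" for w i
      unfolding f_def by (rule triv_frame_sum[OF xU that])
    have "const_section (f w) ?y = \<rho> ?y *\<^sub>R w" if "w \<in> E ?y" for w
      unfolding const_section_eq by (simp add: f_triv frame_expansion[OF yU that])
    then have Bf: "B t (f w) = 0" if "w \<in> E ?y" "P ?y w = 0" for w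
      using that by (simp add: B_def h_def End_scale[OF P] triv_zero[OF triv yU])
    show ?thesis
    proof (rule dim_le_if_linear_inj_on[where f = f])
      show "subspace {w \<in> E ?y. P ?y w = 0}"
        using fibre_subspace[of ?y]
        by (auto simp: subspace_def End_add[OF P] End_scale[OF P] End_zero[OF P])
      show "f (w + w') = f w + f w'"
        if "w \<in> {w \<in> E ?y. P ?y w = 0}" "w' \<in> {w \<in> E ?y. P ?y w = 0}" for w w'
        using that by (simp add: f_def triv_add[OF triv yU] scaleR_add_left sum.distrib)
      show "f (a *\<^sub>R w) = a *\<^sub>R f w" if "w \<in> {w \<in> E ?y. P ?y w = 0}" for w a
        using that by (simp add: f_def triv_scale[OF triv yU] scaleR_sum_right)
      show "inj_on f {w \<in> E ?y. P ?y w = 0}"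
      proof (rule inj_onI)
        fix w w' assume w: "w \<in> {w \<in> E ?y. P ?y w = 0}" "w' \<in> {w \<in> E ?y. P ?y w = 0}" "f w = f w'"
        show "w = w'"
          using w f_triv by (intro triv_inject[OF triv yU]) (auto, metis)
      qed
      show "f ` {w \<in> E ?y. P ?y w = 0} \<subseteq> {w \<in> E x. B t w = 0}"
        using f_in Bf by blast
      show "{w \<in> E x. B t w = 0} \<subseteq> span ((\<lambda>i. frame i x) ` {..<r})"
        using fibre_subset_span by blast
    qed simp
  qed
  have "isCont (\<lambda>t. \<rho> (\<gamma> t)) 0"
    by (rule DERIV_isCont[OF deriv[OF bump(1)]])
  then have "((\<lambda>t. \<rho> (\<gamma> t)) \<longlongrightarrow> 1) (nhds 0)"
    using tendsto_at_iff_tendsto_nhds[of "\<lambda>t. \<rho> (\<gamma> t)" 0]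
    by (simp add: isCont_def \<gamma>(3) bump(2))
  then have "\<forall>\<^sub>F t in nhds 0. \<rho> (\<gamma> t) \<noteq> 0"
    by (rule tendsto_imp_eventually_ne) simp
  have "b \<in> B 0 ` E x"
  proof (rule derivative_in_range_of_const_nullity[OF fibre_subspace fibre_subset_span finite_imageI[OF finite_lessThan]])
    show "B t (w + w') = B t w + B t w'" if "w \<in> E x" "w' \<in> E x" for t w w'
      by (simp add: B_def h_add[OF that] scaleR_add_left sum.distrib)
    show "B t (a *\<^sub>R w) = a *\<^sub>R B t w" if "w \<in> E x" for t w a
      by (simp add: B_def h_scale[OF that] scaleR_sum_right)
    show "isCont (\<lambda>t. l (B t w) :: real) 0" if l: "linear l" for l w
      unfolding B_def linear_sum[OF l] linear_scale[OF l]
      by (intro continuous_intros DERIV_isCont[OF deriv[OF h]]) auto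
    show "((\<lambda>t. l (B t u)) has_real_derivative l b) (at 0)" if l: "linear l" for l
      unfolding B_def b linear_sum[OF l] linear_scale[OF l] real_scaleR_def
      by (intro DERIV_sum DERIV_cmult_right deriv h) auto
    show "u \<in> E x" "B 0 u = 0" using u B0 by auto
    have "dim {w \<in> E x. P x w = 0} = d"
      using eventually_nhds_x_imp_x[OF nullity] by (simp add: \<gamma>(3))
    moreover have "{w \<in> E x. B 0 w = 0} = {w \<in> E x. P x w = 0}"
      using B0 by auto
    ultimately have d: "dim {w \<in> E x. B 0 w = 0} = d" by simp
    show "\<forall>\<^sub>F t in nhds 0. dim {w \<in> E x. B 0 w = 0} \<le> dim {w \<in> E x. B t w = 0}"
      using nullity \<open>\<forall>\<^sub>F t in nhds 0. \<rho> (\<gamma> t) \<noteq> 0\<close>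
    proof eventually_elim
      case (elim t)
      then show ?case using ker[of t] d by linarith
    qed
  qed
  then obtain w where w: "w \<in> E x" "b = P x w" using B0 by auto
  have Du: "D x v (const_section u) \<in> E x" by (rule D_in[OF v const])
  have "nabla_End A r E T D x v P u = b - P x (D x v (const_section u))"
    using nabla_End_eq[OF v P const[of u]] u(1) by (simp add: const_section_at D_commutator_def b_def)
  also have "\<dots> = P x (w - D x v (const_section u))"
    using End_diff[OF P w(1) Du] w(2) by simp
  finally show ?thesis
    using subspace_diff[OF fibre_subspace w(1) Du] by (simp add: v_def)
qed

lemma tangent_const:
  assumes "smooth_manifold A" "v \<in> tangent_space A x"
  shows "v (\<lambda>y. c) = 0"
proof -
  have s: "smooth_fun A (\<lambda>y. c)" for c by (rule smooth_fun_on_const[OF assms(1)])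
  have prod: "\<And>f g. smooth_fun A f \<Longrightarrow> smooth_fun A g \<Longrightarrow> v (\<lambda>y. f y * g y) = v f * g x + f x * v g"
    and scale: "\<And>c f. smooth_fun A f \<Longrightarrow> v (\<lambda>y. c * f y) = c * v f"
    using assms(2) unfolding tangent_space_def by blast+
  have "v (\<lambda>y. 1) = 0" using prod[OF s[of 1] s[of 1]] by simp
  then show ?thesis using scale[OF s[of 1], of c] by simp
qed

lemma (in bundle_frame) nabla_End_add_scale:
  assumes v: "v \<in> tangent_space A x" and J: "smooth_End_section A r E T J"
    and K: "smooth_End_section A r E T K" and u: "u \<in> E x"
  shows "nabla_End A r E T D x v (\<lambda>y u. J y u + c *\<^sub>R K y u) u =
    nabla_End A r E T D x v J u + c *\<^sub>R nabla_End A r E T D x v K u"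
proof -
  note s = smooth_const_section[OF v, of u]
  note Js = smooth_section_End[OF J s]
  note Ks = smooth_section_End[OF K s]
  note c = smooth_fun_on_const[OF manifold, of UNIV c]
  have "D x v (\<lambda>y. c *\<^sub>R K y (const_section u y)) = c *\<^sub>R D x v (\<lambda>y. K y (const_section u y))"
    using D_Leibniz[OF v Ks c] tangent_const[OF manifold v] by simp
  then have "D_commutator x v (\<lambda>y u. J y u + c *\<^sub>R K y u) (const_section u) =
      D_commutator x v J (const_section u) + c *\<^sub>R D_commutator x v K (const_section u)"
    using D_add[OF v Js smooth_section_scale[OF c Ks]]
    by (simp add: D_commutator_def algebra_simps)
  then show ?thesis
    using nabla_End_eq[OF v _ s] J K smooth_End_add_scale[OF J K] u
    by (simp add: const_section_at)
qed

text \<open>Since \<open>J\<close> is parallel, \<open>\<nabla>\<^sub>v (J + c K) = c \<nabla>\<^sub>v K\<close>, and \<open>c \<noteq> 0\<close> can be divided out of the range.\<close>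

lemma (in bundle_connection) nabla_K_maps_kernel_into_range:
  assumes J: "smooth_End_section A r E T J" "parallel_End A r E T D J"
    and K: "smooth_End_section A r E T K"
    and "c \<noteq> 0"
    and curve: "curve_through A N x v"
    and N: "\<And>y. y \<in> N \<Longrightarrow> dim {w \<in> E y. J y w + c *\<^sub>R K y w = 0} = d"
    and u: "u \<in> E x" "J x u + c *\<^sub>R K x u = 0"
  shows "nabla_End A r E T D x v K u \<in> (\<lambda>w. J x w + c *\<^sub>R K x w) ` E x"
proof -
  obtain U \<tau> \<rho> C where "bundle_frame A r E T D x U \<tau> \<rho> C" by (rule bundle_frame_exists)
  then interpret bundle_frame A r E T D x U \<tau> \<rho> C .
  obtain I \<gamma> where \<gamma>: "smooth_curve A I \<gamma>" "0 \<in> I" "\<gamma> 0 = x"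
      "\<forall>\<^sub>F t in nhds 0. \<gamma> t \<in> N" "velocity A \<gamma> 0 = v"
    using curve unfolding curve_through_def by blast
  have v: "v \<in> tangent_space A x"
    using velocity_in_tangent_space[OF manifold \<gamma>(1,2)] by (simp add: \<gamma>(3,5))
  define P where "P = (\<lambda>y u. J y u + c *\<^sub>R K y u)"
  have P: "smooth_End_section A r E T P"
    unfolding P_def by (rule smooth_End_add_scale[OF J(1) K])
  have "\<forall>\<^sub>F t in nhds 0. dim {w \<in> E (\<gamma> t). P (\<gamma> t) w = 0} = d"
    using \<gamma>(4) by eventually_elim (use N in \<open>simp add: P_def\<close>)
  from nabla_maps_kernel_into_range[OF P \<gamma>(1-3) this u(1)] u(2)
  have "nabla_End A r E T D x v P u \<in> P x ` E x" by (simp add: P_def \<gamma>(5))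
  moreover have "nabla_End A r E T D x v J u = 0"
    using J(2) v u(1) unfolding parallel_End_def by blast
  then have "nabla_End A r E T D x v P u = c *\<^sub>R nabla_End A r E T D x v K u"
    using nabla_End_add_scale[OF v J(1) K u(1), of c] by (simp add: P_def)
  ultimately obtain w where w: "w \<in> E x" "c *\<^sub>R nabla_End A r E T D x v K u = P x w" by auto
  have "nabla_End A r E T D x v K u = inverse c *\<^sub>R P x w"
    using \<open>c \<noteq> 0\<close> by (simp flip: w(2))
  also have "\<dots> = P x (inverse c *\<^sub>R w)" by (rule End_scale[OF P w(1), symmetric])
  finally have "nabla_End A r E T D x v K u \<in> P x ` E x"
    using subspace_scale[OF fibre_subspace w(1)] by blast
  then show ?thesis by (simp add: P_def)
qed

theorem proposition7p9:
  fixes A :: "('m::{t2_space,second_countable_topology}, 'e::real_inner) atlas"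
    and n m\<^sub>1 m\<^sub>2 :: nat
    and E :: "'m \<Rightarrow> 'v::real_vector set"
    and T :: "('m, 'v) bundle_atlas"
    and D :: "('m, 'v) covariant_derivative"
    and J K :: "'m \<Rightarrow> 'v \<Rightarrow> 'v"
    and x :: 'm
    and v :: "'m tangent"
  assumes "smooth_manifold A"
    and "vector_bundle A (2 * n) E T"
    and "connection A (2 * n) E T D"
    and "smooth_complex_structure A (2 * n) E T J"
    and "smooth_complex_structure A (2 * n) E T K"
    and "parallel_End A (2 * n) E T D J"
  shows "(x \<in> M_plus E J K m\<^sub>1 \<and> curve_through A (M_plus E J K m\<^sub>1) x v \<longrightarrow>
            nabla_End A (2 * n) E T D x v K ` Ker_plus E J K x \<subseteq> Im_plus E J K x) \<and>
         (x \<in> M_minus E J K m\<^sub>2 \<and> curve_through A (M_minus E J K m\<^sub>2) x v \<longrightarrow>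
            nabla_End A (2 * n) E T D x v K ` Ker_minus E J K x \<subseteq> Im_minus E J K x) \<and>
         (x \<in> M_both E J K m\<^sub>1 m\<^sub>2 \<and> curve_through A (M_both E J K m\<^sub>1 m\<^sub>2) x v \<longrightarrow>
            nabla_End A (2 * n) E T D x v K ` Ker_plus E J K x \<subseteq> Im_plus E J K x \<and>
            nabla_End A (2 * n) E T D x v K ` Ker_minus E J K x \<subseteq> Im_minus E J K x)"
proof -
  interpret bundle_connection A "2 * n" E T D
    using assms(1-3) by unfold_locales
  have J: "smooth_End_section A (2 * n) E T J" and K: "smooth_End_section A (2 * n) E T K"
    using assms(4,5) unfolding smooth_complex_structure_def by auto
  note main = nabla_K_maps_kernel_into_range[OF J assms(6) K]
  have plus: "nabla_End A (2 * n) E T D x v K ` Ker_plus E J K x \<subseteq> Im_plus E J K x"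
    if "curve_through A N x v" "N \<subseteq> M_plus E J K m\<^sub>1" for N
    using main[OF _ that(1), of 1 "2 * m\<^sub>1"] that(2)
    unfolding Ker_plus_def Im_plus_def M_plus_def by auto
  have minus: "nabla_End A (2 * n) E T D x v K ` Ker_minus E J K x \<subseteq> Im_minus E J K x"
    if "curve_through A N x v" "N \<subseteq> M_minus E J K m\<^sub>2" for N
    using main[OF _ that(1), of "- 1" "2 * m\<^sub>2"] that(2)
    unfolding Ker_minus_def Im_minus_def M_minus_def by auto
  show ?thesis
    using plus minus unfolding M_both_def by blast
qed

end
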